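(* Assume $M\notin\{0,-2,-4,\dots\}$ and let $l\ge1$ be an integer. Then the superfunction \[ \nu_{2l}^{m|2n}(\mathbf{x})=\pi^n2^{2n}\frac{(n+l-1)!}{(l-1)!}\,\nu_{2l+2n}^{m}(R^2) \] is a fundamental solution of $\nabla^{2l}$, i.e. $\nabla^{2l}\nu_{2l}^{m|2n}=(-1)^l\delta(\mathbf{x})$ in the distributional sense. Equivalently, \[ \nu_{2l}^{m|2n}(\mathbf{x})= \begin{cases} R^{2l-M}/\gamma_{l-1,M}& M\ \text{odd},\\ R^{2l-M}/\gamma'_{l-1,M}& M\ \text{even and}\ l<\frac{M}{2},\\ -R^{2l-M}\log(R)/\gamma'_{l-1,M}&M\ \text{even and}\ l\ge \frac{M}{2}. \end{cases} \]
   Context: Fix integers $m\ge1$, $n\ge0$ and put $M=m-2n$. Let $\Lambda_{2n}$ be the complex Grassmann algebra generated by anticommuting variables ${x\grave{}}_1,\dots,{x\grave{}}_{2n}$; superfunctions are $f=\sum_A{x\grave{}}_Af_A$ with $\mathbb{C}$-valued coefficients on (subsets of) $\mathbb{R}^m$. Bosonic coordinates $\underline x=(x_1,\dots,x_m)$, $r^2=\sum x_i^2$. Fermionic derivatives $\partial_{{x\grave{}}_j}$ commute with the $x_i$ and satisfy $\partial_{{x\grave{}}_j}({x\grave{}}_k g)=\delta_{jk}g-{x\grave{}}_k\partial_{{x\grave{}}_j}g$. Put $\underline{x}\grave{}^2=\sum_{j=1}^n{x\grave{}}_{2j-1}{x\grave{}}_{2j}$, $R^2=r^2-\underline{x}\grave{}^2$,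 and for a smooth $h$ on $(0,\infty)$, $h(R^2)=\sum_{j=0}^n(-1)^j\frac{\underline{x}\grave{}^{2j}}{j!}h^{(j)}(r^2)$; in particular $R^{\beta}$ means $h(R^2)$ with $h(s)=s^{\beta/2}$, and $R^{\beta}\log R$ means $h(R^2)$ with $h(s)=\tfrac12 s^{\beta/2}\log s$. The super Laplace operator is $\nabla^2=\sum_{i=1}^m\partial_{x_i}^2-4\sum_{j=1}^n\partial_{{x\grave{}}_{2j-1}}\partial_{{x\grave{}}_{2j}}$ (acting on coefficients distributionally), and $\delta(\mathbf{x})=\delta(\underline{x})\frac{\pi^n\underline{x}\grave{}^{2n}}{n!}$. For integers $d\ge1$, $j\ge1$, $\nu_{2j}^d$ denotes the radial bosonic fundamental solution of $\nabla_b^{2j}$ on $\mathbb{R}^d$ (i.e. $\nabla_b^{2j}\nu^d_{2j}=(-1)^j\delta$, $\nabla_b^2$ the Laplacian of $\mathbb{R}^d$), written as a function of $r^2$: $\nu^d_{2j}=r^{2j-d}/\gamma_{j-1,d}$ if $d$ is odd, $\nu^d_{2j}=r^{2j-d}/\gamma'_{j-1,d}$ if $d$ is even and $j<d/2$, $\nu^d_{2j}=-r^{2j-d}\log(r)/\gamma'_{j-1,d}$ if $d$ is even and $j\ge d/2$, where $\gamma_{p,d}=2^{2p+1}p!\,\frac{2\pi^{d/2}}{\Gamma(d/2-p-1)}$ (this formula is also used for odd, possibly negative, $d=M$) and $\gamma'_{p,d}$ are the nonzero normalising constants making these bosonic fundamental solutions correct. *)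

theory Defs
  imports "HOL-Analysis.Analysis"
begin

definition Rspace :: "nat \<Rightarrow> (nat \<Rightarrow> real) set" where
  "Rspace d = ({..<d} \<rightarrow>\<^sub>E (UNIV :: real set))"

definition Rmeas :: "nat \<Rightarrow> (nat \<Rightarrow> real) measure" where
  "Rmeas d = PiM {..<d} (\<lambda>_. (lborel :: real measure))"

definition origin :: "nat \<Rightarrow> nat \<Rightarrow> real" where
  "origin d = (\<lambda>i\<in>{..<d}. 0)"

definition rsq :: "nat \<Rightarrow> (nat \<Rightarrow> real) \<Rightarrow> real" where
  "rsq d x = (\<Sum>i<d. (x i)^2)"

definition pdiff :: "nat \<Rightarrow> ((nat \<Rightarrow> real) \<Rightarrow> complex) \<Rightarrow> (nat \<Rightarrow> real) \<Rightarrow> complex" where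
  "pdiff i g x = vector_derivative (\<lambda>t. g (x(i := x i + t))) (at 0)"

primrec ipd :: "nat list \<Rightarrow> ((nat \<Rightarrow> real) \<Rightarrow> complex) \<Rightarrow> (nat \<Rightarrow> real) \<Rightarrow> complex" where
  "ipd [] g = g"
| "ipd (i # is) g = pdiff i (ipd is g)"

definition blap :: "nat \<Rightarrow> ((nat \<Rightarrow> real) \<Rightarrow> complex) \<Rightarrow> (nat \<Rightarrow> real) \<Rightarrow> complex" where
  "blap d g x = (\<Sum>i<d. pdiff i (pdiff i g) x)"

definition test_fun :: "nat \<Rightarrow> ((nat \<Rightarrow> real) \<Rightarrow> complex) \<Rightarrow> bool" where
  "test_fun d \<phi> \<longleftrightarrow>
     (\<forall>is. set is \<subseteq> {..<d} \<longrightarrow>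
        continuous_on (Rspace d) (ipd is \<phi>) \<and>
        (\<forall>i<d. \<forall>x\<in>Rspace d.
            ((\<lambda>t. ipd is \<phi> (x(i := x i + t))) has_vector_derivative ipd (i # is) \<phi> x) (at 0)))
   \<and> (\<exists>K. \<forall>x\<in>Rspace d. rsq d x > K \<longrightarrow> \<phi> x = 0)"

text \<open>F (a function of r^2) gives a (radial) fundamental solution of the j-th power of
  the Laplacian of R^d: Laplacian^j F = (-1)^j delta, distributionally.\<close>
definition bfs :: "nat \<Rightarrow> nat \<Rightarrow> (real \<Rightarrow> real) \<Rightarrow> bool" where
  "bfs d j F \<longleftrightarrow> (\<forall>\<phi>. test_fun d \<phi> \<longrightarrow>
      integrable (Rmeas d) (\<lambda>x. complex_of_real (F (rsq d x)) * (blap d ^^ j) \<phi> x) \<and>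
      integral\<^sup>L (Rmeas d) (\<lambda>x. complex_of_real (F (rsq d x)) * (blap d ^^ j) \<phi> x)
        = (-1)^j * \<phi> (origin d))"

definition gamma_c :: "nat \<Rightarrow> int \<Rightarrow> real" where
  "gamma_c p d = 2^(2*p+1) * fact p * (2 * pi powr (real_of_int d / 2) / Gamma (real_of_int d / 2 - real p - 1))"

definition gamma'_c :: "nat \<Rightarrow> nat \<Rightarrow> real" where
  "gamma'_c p d = (THE c. c \<noteq> 0 \<and> bfs d (Suc p)
      (\<lambda>s. if 2 * Suc p < d then s powr ((2 * real (Suc p) - real d) / 2) / c
           else - (s powr ((2 * real (Suc p) - real d) / 2) * (ln s / 2)) / c))"

text \<open>nu^d_{2j} as a function of s = r^2.\<close>
definition nu :: "nat \<Rightarrow> nat \<Rightarrow> real \<Rightarrow> real" where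
  "nu d j s = (if odd d then s powr ((2 * real j - real d) / 2) / gamma_c (j - 1) (int d)
     else if 2 * j < d then s powr ((2 * real j - real d) / 2) / gamma'_c (j - 1) d
     else - (s powr ((2 * real j - real d) / 2) * (ln s / 2)) / gamma'_c (j - 1) d)"

text \<open>An element of the Grassmann algebra is given by its coefficients: g A is the
  coefficient of x`_A = x`_{a1} ... x`_{ak}, a1 < ... < ak, A = {a1,...,ak}.
  Generators are indexed 1..2n.\<close>

definition gsign :: "nat set \<Rightarrow> nat set \<Rightarrow> complex" where
  "gsign A B = (-1) ^ card {(a, b). a \<in> A \<and> b \<in> B \<and> b < a}"

definition gmul :: "(nat set \<Rightarrow> complex) \<Rightarrow> (nat set \<Rightarrow> complex) \<Rightarrow> nat set \<Rightarrow> complex" where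
  "gmul f g C = (\<Sum>A\<in>Pow C. gsign A (C - A) * f A * g (C - A))"

definition gen :: "nat \<Rightarrow> nat set \<Rightarrow> complex" where
  "gen k = (\<lambda>A. if A = {k} then 1 else 0)"

definition gone :: "nat set \<Rightarrow> complex" where
  "gone = (\<lambda>A. if A = {} then 1 else 0)"

primrec gpow :: "(nat set \<Rightarrow> complex) \<Rightarrow> nat \<Rightarrow> nat set \<Rightarrow> complex" where
  "gpow f 0 = gone"
| "gpow f (Suc j) = gmul f (gpow f j)"

definition xgr2 :: "nat \<Rightarrow> nat set \<Rightarrow> complex" where
  "xgr2 n = (\<lambda>A. \<Sum>j\<in>{1..n}. gmul (gen (2*j-1)) (gen (2*j)) A)"

definition fder :: "nat \<Rightarrow> (nat set \<Rightarrow> 'a::ab_group_add) \<Rightarrow> nat set \<Rightarrow> 'a" where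
  "fder j T B = (if j \<in> B then 0
      else if even (card {b\<in>B. b < j}) then T (insert j B) else - T (insert j B))"

text \<open>h(R^2) as a superfunction on R^m with 2n Grassmann generators.\<close>
definition sfunR2 :: "nat \<Rightarrow> nat \<Rightarrow> (real \<Rightarrow> real) \<Rightarrow> (nat \<Rightarrow> real) \<Rightarrow> nat set \<Rightarrow> complex" where
  "sfunR2 m n h x = (\<lambda>A. \<Sum>j\<le>n. complex_of_real ((-1)^j / fact j * (deriv ^^ j) h (rsq m x))
                                * gpow (xgr2 n) j A)"

text \<open>Grassmann-valued distributions: T A \<phi> is the pairing of the x`_A-coefficient
  with the test function \<phi>.\<close>
type_synonym gdist = "nat set \<Rightarrow> ((nat \<Rightarrow> real) \<Rightarrow> complex) \<Rightarrow> complex"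

definition sdist :: "nat \<Rightarrow> ((nat \<Rightarrow> real) \<Rightarrow> nat set \<Rightarrow> complex) \<Rightarrow> gdist" where
  "sdist m f = (\<lambda>A \<phi>. integral\<^sup>L (Rmeas m) (\<lambda>x. f x A * \<phi> x))"

definition slap :: "nat \<Rightarrow> nat \<Rightarrow> gdist \<Rightarrow> gdist" where
  "slap m n T = (\<lambda>A \<phi>. T A (blap m \<phi>)
      - 4 * (\<Sum>j\<in>{1..n}. fder (2*j-1) (fder (2*j) (\<lambda>B. T B \<phi>)) A))"

definition sdelta :: "nat \<Rightarrow> nat \<Rightarrow> gdist" where
  "sdelta m n = (\<lambda>A \<phi>. \<phi> (origin m) * complex_of_real (pi^n / fact n) * gpow (xgr2 n) n A)"

definition supernu :: "nat \<Rightarrow> nat \<Rightarrow> nat \<Rightarrow> (nat \<Rightarrow> real) \<Rightarrow> nat set \<Rightarrow> complex" where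
  "supernu m n l x = (\<lambda>A. complex_of_real (pi^n * 2^(2*n) * fact (n+l-1) / fact (l-1))
                          * sfunR2 m n (nu m (l+n)) x A)"

text \<open>The right-hand side of the "equivalently" formula, as h with nu = h(R^2),
  where M = m - 2n.\<close>
definition nu_equiv :: "nat \<Rightarrow> nat \<Rightarrow> nat \<Rightarrow> real \<Rightarrow> real" where
  "nu_equiv m n l s = (let M = int m - 2 * int n; e = (2 * real l - real_of_int M) / 2 in
     if odd M then s powr e / gamma_c (l - 1) M
     else if 2 * int l < M then s powr e / gamma'_c (l - 1) (nat M)
     else - (s powr e * (ln s / 2)) / gamma'_c (l - 1) (nat M))"

end

theory Submission
  imports Defs "HOL-Probability.Distributions"
begin

text \<open>
  A radial superfunction $h(R^2)$ is acted on by $\nabla^2$ as if $R^2$ were the squared radius of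
  a space of dimension $M = m - 2n$: away from the origin it becomes $(4 s h'' + 2 M h')(R^2)$,
  because the fermionic part lowers $m$ by $2(n-j)$ in the coefficient of $\grave{x}^{2j}$.
  On powers and logarithms this is a triangular map with constant coefficients.
  After $l - 1$ steps one reaches $h' = \rho\, s^{-M/2}$, which is annihilated, except that the
  coefficient of $\grave{x}^{2n}$ is a multiple of the fundamental solution of the bosonic Laplacian
  of $\mathbb{R}^m$ and yields $\delta$. Singularities are handled by replacing $r^2$ by
  $r^2 + \epsilon$, integrating by parts, and letting $\epsilon \to 0$; the only term
  that does not converge trivially contains the approximate identity
  $\epsilon\,(r^2+\epsilon)^{-m/2-1}$. The case $n = 0$ identifies the normalising constants
  \<open>gamma'_c\<close>, whose uniqueness needs one test function that does not vanish at $0$.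
\<close>

section \<open>Power-logarithm functions\<close>

text \<open>Two facts make the constants fit. The Gamma argument satisfies m/2 - (l + n) = M/2 - l,
  so passing from (m, l + n) to (M, l) changes only powers of 2 and pi and a factorial, which
  together are the prefactor in \<open>supernu\<close>; in the logarithmic range the residue depends
  on the same difference. Differentiating \<rho> s^(-M/2) another n times produces a Pochhammer
  symbol, up to sign Gamma(m/2) / Gamma(M/2), which converts the normalisation of dimension M into
  that of dimension m. This is where M/2 must avoid the poles of Gamma.

  The exponents are tight too: after l - 1 steps the coefficient of index n has exponent 1 - m/2 in
  r^2, the singularity of the bosonic fundamental solution, so every earlier integration by parts is
  strictly subcritical.

  Iterated \<open>deriv\<close> is informative only for r > 0, and \<open>gamma'_c\<close> is a
  description rather than a value. Both are therefore replaced by explicit data: coefficient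
  triples, and the closed formula \<open>gamma_expl\<close>.\<close>

definition plog :: "real \<times> real \<times> real \<Rightarrow> real \<Rightarrow> real" where
  "plog t s = (case t of (b, a, c) \<Rightarrow> s powr b * (a + c * ln s))"

text \<open>Neither differentiation nor the radial Laplacian raises the power of the logarithm, so
  the functions s^b (a + c log s) are closed under both, and iterating the operators becomes
  arithmetic on triples.\<close>

fun pl_deriv :: "real \<times> real \<times> real \<Rightarrow> real \<times> real \<times> real" where
  "pl_deriv (b, a, c) = (b - 1, b * a + c, b * c)"

text \<open>\<open>radlap D\<close> represents $4 s h'' + 2 D h'$, the radial part of the Laplacian of a
  $D$-dimensional (super)space written in the variable $s = r^2$.\<close>

definition radlap :: "real \<Rightarrow> real \<times> real \<times> real \<Rightarrow> real \<times> real \<times> real" where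
  "radlap D t = (case pl_deriv t of (b, a, c) \<Rightarrow>
     (b, (4 * b + 2 * D) * a + 4 * c, (4 * b + 2 * D) * c))"

lemma radlap_triple:
  "radlap D (b, a, c) = (b - 1, (4 * (b - 1) + 2 * D) * (b * a + c) + 4 * (b * c),
     (4 * (b - 1) + 2 * D) * (b * c))"
  by (simp add: radlap_def)

lemma has_real_derivative_plog:
  assumes "s > 0"
  shows "(plog t has_real_derivative plog (pl_deriv t) s) (at s)"
proof (cases t)
  case (fields b a c)
  have "((\<lambda>s. s powr b * (a + c * ln s)) has_real_derivative
      s powr (b - 1) * (b * a + c + b * c * ln s)) (at s)"
    using assms
    by (auto intro!: derivative_eq_intros simp: powr_diff field_simps)
  then show ?thesis by (simp add: fields plog_def[abs_def])
qed

lemma fst_pl_deriv [simp]: "fst (pl_deriv t) = fst t - 1"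
  by (cases t) simp

lemma fst_radlap [simp]: "fst (radlap D t) = fst t - 1"
  by (cases t) (simp add: radlap_triple)

lemma fst_funpow_pl_deriv [simp]: "fst ((pl_deriv ^^ k) t) = fst t - real k"
  by (induction k) auto

lemma fst_funpow_radlap [simp]: "fst ((radlap D ^^ k) t) = fst t - real k"
  by (induction k) auto

lemma plog_radlap:
  assumes "s > 0"
  shows "plog (radlap D t) s = 4 * s * plog (pl_deriv (pl_deriv t)) s + 2 * D * plog (pl_deriv t) s"
proof (cases t)
  case (fields b a c)
  have "s * s powr (b - 2) = s powr (b - 1)"
    using assms by (simp add: powr_diff powr_realpow power2_eq_square)
  then have "4 * (s * s powr (b - 2)) * x + 2 * D * (s powr (b - 1) * y)
      = s powr (b - 1) * (4 * x + 2 * D * y)" for x y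
    by (simp add: algebra_simps)
  from this[of "(b - 1) * (b * a + c) + b * c + (b - 1) * (b * c) * ln s" "b * a + c + b * c * ln s"]
  show ?thesis
    by (simp add: fields plog_def radlap_triple algebra_simps)
qed

text \<open>The dimension enters only through 2 D h', so lowering it by 2q costs 4q h'. With q = n -
  j this is the contribution of the fermionic derivatives to the coefficient of index j.\<close>

lemma plog_radlap_shift:
  assumes "s > 0"
  shows "plog (radlap (D - 2 * q) t) s = plog (radlap D t) s - 4 * q * plog (pl_deriv t) s"
  using assms by (simp add: plog_radlap algebra_simps)

text \<open>The derivative of 4 s h'' + 2 D h' is 4 s h''' + (2 D + 4) h'': each derivative of h
  sees two more dimensions. Hence h^(j), for h in dimension M, sees M + 2j = m - 2(n - j).\<close>

lemma pl_deriv_radlap: "pl_deriv (radlap D t) = radlap (D + 2) (pl_deriv t)"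
  by (cases t) (simp add: radlap_triple algebra_simps)

lemma funpow_pl_deriv_radlap:
  "(pl_deriv ^^ k) (radlap D t) = radlap (D + 2 * real k) ((pl_deriv ^^ k) t)"
  by (induction k arbitrary: t) (simp_all add: pl_deriv_radlap algebra_simps)

lemma plog_zero [simp]: "plog (b, 0, 0) s = 0"
  by (simp add: plog_def)

lemma funpow_pl_deriv_zero: "(pl_deriv ^^ k) (b, 0, 0) = (b - real k, 0, 0)"
  by (induction k) auto

lemma funpow_pl_deriv_power:
  "(pl_deriv ^^ k) (b, a, 0) = (b - real k, (\<Prod>i<k. b - real i) * a, 0)"
  by (induction k) (auto simp: algebra_simps)

text \<open>For h' = \<rho> s^(-D/2) the term 4 s h'' equals -2 D h', so the two parts cancel. The
  zero function keeps a formal exponent in its triple.\<close>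

lemma radlap_eq_zero:
  assumes "pl_deriv t = (- D / 2, \<rho>, 0)"
  shows "radlap D t = (- D / 2, 0, 0)"
  using assms by (simp add: radlap_def)

fun pl_scale :: "real \<Rightarrow> real \<times> real \<times> real \<Rightarrow> real \<times> real \<times> real" where
  "pl_scale k (b, a, c) = (b, k * a, k * c)"

lemma pl_deriv_scale: "pl_deriv (pl_scale k t) = pl_scale k (pl_deriv t)"
  by (cases t) (simp add: algebra_simps)

lemma radlap_scale: "radlap D (pl_scale k t) = pl_scale k (radlap D t)"
  by (cases t) (simp add: radlap_triple algebra_simps)

lemma funpow_radlap_scale: "(radlap D ^^ j) (pl_scale k t) = pl_scale k ((radlap D ^^ j) t)"
  by (induction j) (simp_all add: radlap_scale)

text \<open>In the logarithmic case $\Gamma(D/2-p-1)$ has a pole, and its residue $(-1)^q/q!$ with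
  $q = p + 1 - D/2$ takes the place of the value.\<close>

definition gamma_expl :: "nat \<Rightarrow> int \<Rightarrow> real" where
  "gamma_expl p D = (if odd D \<or> 2 * int (Suc p) < D then gamma_c p D
     else (-1) ^ nat (int (Suc p) - D div 2) * 2 ^ (2 * p + 1) * fact p
            * pi powr (of_int D / 2) * fact (nat (int (Suc p) - D div 2)))"

text \<open>The half in the logarithmic case is log r = (log r^2) / 2. An odd D may be negative
  here, as the superdimension can be.\<close>

definition nu_coeffs :: "nat \<Rightarrow> int \<Rightarrow> real \<times> real \<times> real" where
  "nu_coeffs l D = (real l - of_int D / 2,
     (if odd D \<or> 2 * int l < D then (1 / gamma_expl (l - 1) D, 0)
      else (0, - 1 / (2 * gamma_expl (l - 1) D))))"

text \<open>The argument D/2 - l is a half-integer for odd D and positive otherwise, so it is never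
  a pole.\<close>

lemma Gamma_half_plus1:
  fixes D :: int
  assumes "odd D \<or> 2 * int l < D"
  shows "Gamma (of_int D / 2 - real l + 1) = (of_int D / 2 - real l) * Gamma (of_int D / 2 - real l :: real)"
proof (rule Gamma_plus1)
  show "of_int D / 2 - real l \<notin> \<int>\<^sub>\<le>\<^sub>0"
  proof
    assume "of_int D / 2 - real l \<in> \<int>\<^sub>\<le>\<^sub>0"
    then obtain k where k: "of_int D / 2 - real l = of_int k" "k \<le> 0"
      by (auto elim!: nonpos_Ints_cases)
    then have "real_of_int D = of_int (2 * k + 2 * int l)" by simp
    then have "D = 2 * k + 2 * int l" by (simp only: of_int_eq_iff)
    with k assms show False by auto
  qed
qed

text \<open>The coefficient \<open>a\<close> of the logarithm-free term is left arbitrary in the logarithmic case,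
  because such terms are produced along the way; they are polynomials that die in the end.\<close>

lemma pl_deriv_funpow_radlap_fundamental:
  fixes D :: int and l :: nat
  defines "\<rho> \<equiv> \<lambda>l. (-1) ^ l * Gamma (of_int D / 2) / (4 * pi powr (of_int D / 2)) :: real"
  assumes D: "odd D \<or> D > 0"
    and ac: "if odd D \<or> 2 * int (Suc l) < D then a = 1 / gamma_expl l D \<and> c = 0
             else c = - 1 / (2 * gamma_expl l D)"
  shows "pl_deriv ((radlap (of_int D) ^^ l) (real (Suc l) - of_int D / 2, a, c))
     = (- of_int D / 2, \<rho> (Suc l), 0)"
  using ac
proof (induction l arbitrary: a c)
  case 0
  show ?case
  proof (cases "odd D \<or> 2 < D")
    case True
    have G: "Gamma (of_int D / 2) = (of_int D / 2 - 1) * Gamma (of_int D / 2 - 1 :: real)"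
      using Gamma_half_plus1[of D 1] True by simp
    have a: "a = 1 / gamma_c 0 D" "c = 0" using 0 True by (auto simp: gamma_expl_def)
    show ?thesis
      by (simp add: a gamma_c_def \<rho>_def G field_simps)
  next
    case False
    then have D2: "D = 2" using D by (auto elim!: evenE)
    show ?thesis using 0 by (simp add: D2 \<rho>_def gamma_expl_def)
  qed
next
  case (Suc l)
  define b where "b = real (Suc (Suc l)) - of_int D / 2"
  let ?a = "4 * real (Suc l) * b * a + (8 * b - 4 + 2 * of_int D) * c"
  let ?c = "4 * real (Suc l) * b * c"
  have rl: "radlap (of_int D) (b, a, c) = (real (Suc l) - of_int D / 2, ?a, ?c)"
    by (simp add: radlap_triple b_def field_simps)
  \<comment> \<open>One radial Laplacian lowers the order by one and turns the normalisation into
    minus the next one. The induction hypothesis is therefore applied to the negated triple, and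
    \<open>pl_scale (- 1)\<close> undoes the sign; this produces the alternating sign of
    \<rho>.\<close>
  have "if odd D \<or> 2 * int (Suc l) < D then - ?a = 1 / gamma_expl l D \<and> - ?c = 0
        else - ?c = - 1 / (2 * gamma_expl l D)"
  proof (cases "odd D \<or> 2 * int (Suc (Suc l)) < D")
    case True
    have G: "Gamma (of_int D / 2 - real l - 1) = - b * Gamma (of_int D / 2 - real l - 2 :: real)"
      using Gamma_half_plus1[of D "Suc (Suc l)"] True by (simp add: b_def algebra_simps)
    have a: "a = 1 / gamma_c (Suc l) D" "c = 0"
      using Suc.prems True by (auto simp: gamma_expl_def split: if_splits)
    define X where "X = 2 ^ (2 * l + 1) * fact l * (2 * pi powr (of_int D / 2))"
    define g where "g = Gamma (of_int D / 2 - real l - 2 :: real)"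
    have X: "X > 0" by (simp add: X_def)
    have g1: "gamma_c l D = X / (- b * g)"
      unfolding gamma_c_def G g_def[symmetric] X_def by simp
    have g2: "gamma_c (Suc l) D = 4 * real (Suc l) * X / g"
      unfolding gamma_c_def g_def X_def by (simp add: algebra_simps add_divide_distrib)
    have "- ?a = 1 / gamma_c l D"
      unfolding a g1 g2 using X by (simp add: divide_simps)
    then show ?thesis using True a by (auto simp: gamma_expl_def)
  next
    case False
    then have c: "c = - 1 / (2 * gamma_expl (Suc l) D)" using Suc.prems by simp
    obtain k where k: "D = 2 * k" using False by (auto elim: evenE)
    have k1: "k \<ge> 1" "k \<le> int (Suc (Suc l))" using False D k by auto
    show ?thesis
    proof (cases "2 * int (Suc l) < D")
      \<comment> \<open>The boundary between the regimes: D = 2(l + 2), so b = 0 and the function is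
        a multiple of log s plus a constant. Its radial Laplacian is a pure power.\<close>
      case True
      then have kl: "k = int (Suc (Suc l))" using k k1 by simp
      define X where "X = 2 ^ (2 * l + 1) * fact l * pi powr (of_int D / 2)"
      have X: "X > 0" by (simp add: X_def)
      have D: "of_int D / 2 - real l - 1 = (1 :: real)" by (simp add: k kl field_simps)
      have g1: "gamma_c l D = 2 * X"
        unfolding gamma_c_def D X_def by simp
      have g2: "gamma_expl (Suc l) D = 4 * real (Suc l) * X"
        by (simp add: gamma_expl_def k kl X_def)
      have Dl: "real_of_int D = 2 * real l + 4" by (simp add: k kl)
      then have "real_of_int D / 2 = real l + 2" by simp
      then have b0: "b = 0" unfolding b_def by simp
      have b1: "8 * b - 4 + 2 * of_int D = 4 * real (Suc l)" unfolding b0 Dl by simp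
      have "- ?a = 1 / gamma_c l D" "?c = 0"
        unfolding b1 c g1 g2 using X b0 by (simp_all add: divide_simps)
      then show ?thesis using True by (simp add: gamma_expl_def[of l])
    next
      case F2: False
      define q where "q = nat (int (Suc l) - k)"
      have q: "nat (int (Suc (Suc l)) - k) = Suc q" "int (Suc l) - k = int q" "b = real (Suc q)"
        using F2 k by (auto simp: q_def b_def)
      \<comment> \<open>This recursion plays the part of the functional equation of Gamma: raising q
        by one flips the sign of the residue and brings in the factor q + 1 = b.\<close>
      have g: "gamma_expl (Suc l) D = - 4 * real (Suc l) * b * gamma_expl l D"
      proof -
        have D: "D div 2 = k" "nat (int (Suc l) - k) = q" by (simp_all add: k q_def)
        have "\<not> (odd D \<or> 2 * int (Suc l) < D)" using F2 by (simp add: k)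
        then have g1: "gamma_expl l D = (-1) ^ q * 2 ^ (2 * l + 1) * fact l * pi powr (of_int D / 2) * fact q"
          unfolding gamma_expl_def D by (simp only: if_False)
        have g2: "gamma_expl (Suc l) D = (-1) ^ Suc q * 2 ^ (2 * Suc l + 1) * fact (Suc l)
            * pi powr (of_int D / 2) * fact (Suc q)"
          using False unfolding gamma_expl_def D q(1) by (simp only: if_False)
        show ?thesis unfolding g1 g2 q(3) by (simp add: algebra_simps)
      qed
      have "b > 0" by (simp add: q)
      then have cancel: "4 * r * b * (- 1 / (2 * (- 4 * r * b * x))) = 1 / (2 * x)"
        if "r > 0" for r x :: real
        using that by simp
      have "?c = 1 / (2 * gamma_expl l D)"
        unfolding c g by (rule cancel) simp
      moreover have "\<not> (odd D \<or> 2 * int (Suc l) < D)" using F2 by (simp add: k)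
      ultimately show ?thesis by (simp only: if_False)
    qed
  qed
  then have "pl_deriv ((radlap (of_int D) ^^ l) (real (Suc l) - of_int D / 2, - ?a, - ?c))
     = (- of_int D / 2, \<rho> (Suc l), 0)"
    by (rule Suc.IH)
  then have "pl_scale (- 1) (pl_deriv ((radlap (of_int D) ^^ l) (real (Suc l) - of_int D / 2, ?a, ?c)))
     = (- of_int D / 2, \<rho> (Suc l), 0)"
    by (simp add: pl_deriv_scale[symmetric] funpow_radlap_scale[symmetric])
  then have "pl_deriv ((radlap (of_int D) ^^ l) (real (Suc l) - of_int D / 2, ?a, ?c))
     = (- of_int D / 2, \<rho> (Suc (Suc l)), 0)"
    by (cases "pl_deriv ((radlap (of_int D) ^^ l) (real (Suc l) - of_int D / 2, ?a, ?c))")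
       (auto simp: \<rho>_def)
  then show ?case
    unfolding b_def[symmetric] by (simp only: funpow_Suc_right o_apply rl)
qed

section \<open>The Grassmann algebra\<close>

definition pairs :: "nat set \<Rightarrow> nat set" where
  "pairs S = (\<Union>i\<in>S. {2 * i - 1, 2 * i})"

lemma pairs_insert: "pairs (insert i S) = {2 * i - 1, 2 * i} \<union> pairs S"
  by (auto simp: pairs_def)

text \<open>The pairs of distinct positive indices are disjoint. At index 0 truncated subtraction
  would collapse the pair, hence the lower bounds.\<close>

lemma mem_pairs:
  assumes "S \<subseteq> {1..n}" "i \<ge> 1"
  shows "2 * i \<in> pairs S \<longleftrightarrow> i \<in> S" "2 * i - 1 \<in> pairs S \<longleftrightarrow> i \<in> S"
proof -
  have "x = i" if "x \<in> S" "2 * i = 2 * x - 1 \<or> 2 * i = 2 * x \<or> 2 * i - 1 = 2 * x - 1 \<or> 2 * i - 1 = 2 * x" for x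
  proof -
    have "x \<ge> 1" using that assms by auto
    with that(2) assms(2) show ?thesis by presburger
  qed
  then show "2 * i \<in> pairs S \<longleftrightarrow> i \<in> S" "2 * i - 1 \<in> pairs S \<longleftrightarrow> i \<in> S"
    by (auto simp: pairs_def)
qed

lemma pairs_eq_iff:
  assumes "S \<subseteq> {1..n}" "T \<subseteq> {1..n}"
  shows "pairs S = pairs T \<longleftrightarrow> S = T"
proof
  assume "pairs S = pairs T"
  then have "i \<in> S \<longleftrightarrow> i \<in> T" if "i \<ge> 1" for i
    using mem_pairs(1)[OF assms(1) that] mem_pairs(1)[OF assms(2) that] by simp
  then show "S = T" using assms by fastforce
qed simp

lemma pairs_remove:
  assumes "S \<subseteq> {1..n}" "i \<in> S"
  shows "pairs S - {2 * i - 1, 2 * i} = pairs (S - {i})"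
proof -
  have S: "S = insert i (S - {i})" "S - {i} \<subseteq> {1..n}" "i \<ge> 1" using assms by auto
  have "pairs (S - {i}) \<inter> {2 * i - 1, 2 * i} = {}"
    using mem_pairs[OF S(2,3)] by auto
  then show ?thesis
    using pairs_insert[of i "S - {i}"] S(1) by auto
qed

text \<open>Closed form of the j-th power of \<open>xgr2 n\<close>: the quadratic monomials commute
  and square to zero, so the expansion keeps each set of j distinct pairs, j! times.\<close>

definition pair_power :: "nat \<Rightarrow> nat \<Rightarrow> nat set \<Rightarrow> complex" where
  "pair_power n j A = (if \<exists>S\<subseteq>{1..n}. card S = j \<and> A = pairs S then fact j else 0)"

lemma pair_power_pairs:
  assumes "S \<subseteq> {1..n}"
  shows "pair_power n j (pairs S) = (if card S = j then fact j else 0)"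
  using assms pairs_eq_iff[OF assms] unfolding pair_power_def by metis

lemma pair_power_eq_0:
  assumes "\<And>S. S \<subseteq> {1..n} \<Longrightarrow> A \<noteq> pairs S"
  shows "pair_power n j A = 0"
  using assms by (auto simp: pair_power_def)

lemma finite_pairs: "S \<subseteq> {1..n} \<Longrightarrow> finite (pairs S)"
  unfolding pairs_def by (rule finite_UN_I) (auto dest: finite_subset)

lemma gmul_gen_pair:
  assumes "a < b"
  shows "gmul (gen a) (gen b) A = (if A = {a, b} then 1 else 0)"
proof (cases "finite A")
  case True
  have "gsign B (A - B) * gen a B * gen b (A - B) = (if B = {a} then (if A = {a, b} then 1 else 0) else 0)"
    if "B \<in> Pow A" for B
  proof -
    have "{(x, y). x \<in> {a} \<and> y \<in> {b} \<and> y < x} = {}" using assms by auto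
    then have "gsign {a} {b} = 1" unfolding gsign_def by (simp only: card.empty power_0)
    moreover have "A - {a} = {b} \<longleftrightarrow> A = {a, b}" if "a \<in> A" using that assms by auto
    ultimately show ?thesis using that by (auto simp: gen_def)
  qed
  then have "gmul (gen a) (gen b) A = (\<Sum>B\<in>Pow A. if B = {a} then (if A = {a, b} then 1 else 0) else 0)"
    unfolding gmul_def by (intro sum.cong) auto
  then show ?thesis using True by (auto simp: sum.delta)
qed (auto simp: gmul_def)

lemma xgr2_eq: "xgr2 n A = (\<Sum>i\<in>{1..n}. if A = {2 * i - 1, 2 * i} then 1 else 0)"
  unfolding xgr2_def by (intro sum.cong refl) (simp add: gmul_gen_pair)

text \<open>An element of B lies below both members of the pair or above both, so the inversions
  come in twos.\<close>

lemma gsign_pair: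
  assumes "i \<ge> 1" "finite B" "2 * i - 1 \<notin> B" "2 * i \<notin> B"
  shows "gsign {2 * i - 1, 2 * i} B = 1"
proof -
  let ?L = "{b\<in>B. b < 2 * i}"
  have "b < 2 * i - 1 \<longleftrightarrow> b < 2 * i" if "b \<in> B" for b
    using that assms by (cases "b = 2 * i - 1") auto
  then have "{(a, b). a \<in> {2 * i - 1, 2 * i} \<and> b \<in> B \<and> b < a} = {2 * i - 1, 2 * i} \<times> ?L"
    by auto
  moreover have "2 * i - 1 \<noteq> 2 * i" using assms by simp
  ultimately have "card {(a, b). a \<in> {2 * i - 1, 2 * i} \<and> b \<in> B \<and> b < a} = 2 * card ?L"
    by (simp only: card_cartesian_product) simp
  then show ?thesis by (simp only: gsign_def) simp
qed

lemma gmul_xgr2: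
  assumes "finite A"
  shows "gmul (xgr2 n) g A =
    (\<Sum>i\<in>{i\<in>{1..n}. 2 * i - 1 \<in> A \<and> 2 * i \<in> A}. g (A - {2 * i - 1, 2 * i}))"
proof -
  have "gmul (xgr2 n) g A = (\<Sum>B\<in>Pow A. \<Sum>i\<in>{1..n}.
      if B = {2 * i - 1, 2 * i} then gsign B (A - B) * g (A - B) else 0)"
    unfolding gmul_def xgr2_eq
    by (intro sum.cong) (auto simp: sum_distrib_left sum_distrib_right intro!: sum.cong)
  also have "\<dots> = (\<Sum>i\<in>{1..n}. \<Sum>B\<in>Pow A.
      if B = {2 * i - 1, 2 * i} then gsign B (A - B) * g (A - B) else 0)"
    by (rule sum.swap)
  also have "\<dots> = (\<Sum>i\<in>{1..n}. if 2 * i - 1 \<in> A \<and> 2 * i \<in> A then g (A - {2 * i - 1, 2 * i}) else 0)"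
  proof (intro sum.cong refl)
    fix i assume i: "i \<in> {1..n}"
    have "gsign {2 * i - 1, 2 * i} (A - {2 * i - 1, 2 * i}) = 1"
      using i assms by (intro gsign_pair) auto
    then show "(\<Sum>B\<in>Pow A. if B = {2 * i - 1, 2 * i} then gsign B (A - B) * g (A - B) else 0)
      = (if 2 * i - 1 \<in> A \<and> 2 * i \<in> A then g (A - {2 * i - 1, 2 * i}) else 0)"
      using assms by (simp add: sum.delta del: One_nat_def)
  qed
  also have "\<dots> = (\<Sum>i\<in>{i\<in>{1..n}. 2 * i - 1 \<in> A \<and> 2 * i \<in> A}. g (A - {2 * i - 1, 2 * i}))"
    by (rule sum.inter_filter[symmetric]) simp
  finally show ?thesis .
qed

lemma gpow_xgr2: "gpow (xgr2 n) j = pair_power n j"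
proof (induction j)
  case 0
  show ?case
  proof
    fix A
    have "(\<exists>S\<subseteq>{1..n}. card S = 0 \<and> A = pairs S) \<longleftrightarrow> A = {}"
      by (auto simp: pairs_def dest: finite_subset)
    then show "gpow (xgr2 n) 0 A = pair_power n 0 A" by (simp add: gone_def pair_power_def)
  qed
next
  case (Suc j)
  show ?case
  proof
    fix A
    show "gpow (xgr2 n) (Suc j) A = pair_power n (Suc j) A"
    proof (cases "\<exists>S\<subseteq>{1..n}. A = pairs S")
      case True
      then obtain S where S: "S \<subseteq> {1..n}" "A = pairs S" by blast
      have fS: "finite S" using S finite_subset by blast
      have ind: "{i\<in>{1..n}. 2 * i - 1 \<in> A \<and> 2 * i \<in> A} = S"
        using S(1) mem_pairs[OF S(1)] unfolding S(2) by (auto simp del: One_nat_def)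
      have "gpow (xgr2 n) (Suc j) A = (\<Sum>i\<in>S. pair_power n j (A - {2 * i - 1, 2 * i}))"
        using Suc gmul_xgr2[OF finite_pairs[OF S(1)]] ind S(2) by simp
      \<comment> \<open>Each of the j + 1 pairs can be the factor split off, which turns j! into (j
        + 1)!.\<close>
      also have "\<dots> = (\<Sum>i\<in>S. if card S = Suc j then fact j else 0)"
      proof (intro sum.cong refl)
        fix i assume i: "i \<in> S"
        have "card (S - {i}) = j \<longleftrightarrow> card S = Suc j"
          using i fS by (metis card_Suc_Diff1 nat.inject)
        then show "pair_power n j (A - {2 * i - 1, 2 * i}) = (if card S = Suc j then fact j else 0)"
          using pair_power_pairs[of "S - {i}" n j] unfolding S(2) pairs_remove[OF S(1) i]
          by (metis Diff_subset order_trans S(1))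
      qed
      also have "\<dots> = pair_power n (Suc j) A"
        using S by (simp add: pair_power_pairs)
      finally show ?thesis .
    next
      case False
      have "pair_power n j (A - {2 * i - 1, 2 * i}) = 0"
        if i: "i \<in> {1..n}" "2 * i - 1 \<in> A" "2 * i \<in> A" for i
      proof (rule pair_power_eq_0)
        fix S assume S: "S \<subseteq> {1..n}"
        show "A - {2 * i - 1, 2 * i} \<noteq> pairs S"
        proof
          assume "A - {2 * i - 1, 2 * i} = pairs S"
          then have "A = pairs (insert i S)" using i by (auto simp: pairs_insert)
          moreover have "insert i S \<subseteq> {1..n}" using S i by auto
          ultimately show False using False by blast
        qed
      qed
      then have "gmul (xgr2 n) (pair_power n j) A = 0"
        by (cases "finite A") (simp_all add: gmul_xgr2 del: One_nat_def, simp add: gmul_def)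
      moreover have "pair_power n (Suc j) A = 0"
        using False by (intro pair_power_eq_0) auto
      ultimately show ?thesis using Suc by simp
    qed
  qed
qed

text \<open>Both derivatives cross the generators of A below 2i - 1, so these signs cancel; the
  derivative in the generator 2i also crosses the generator 2i - 1, which leaves one minus
  sign.\<close>

lemma fder_pair:
  assumes "i \<ge> 1"
  shows "fder (2 * i - 1) (fder (2 * i) T) A =
    (if 2 * i - 1 \<notin> A \<and> 2 * i \<notin> A then - T (A \<union> {2 * i - 1, 2 * i}) else 0)"
proof (cases "2 * i - 1 \<notin> A \<and> 2 * i \<notin> A")
  case True
  let ?L = "{b\<in>A. b < 2 * i - 1}"
  have "{b \<in> insert (2 * i - 1) A. b < 2 * i} = insert (2 * i - 1) ?L"
    using assms by (auto simp: less_Suc_eq)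
  then have "card {b \<in> insert (2 * i - 1) A. b < 2 * i} = Suc (card ?L)"
    by simp
  moreover have "insert (2 * i) (insert (2 * i - 1) A) = A \<union> {2 * i - 1, 2 * i}" by auto
  moreover have "2 * i \<noteq> 2 * i - 1" using assms by simp
  ultimately show ?thesis using True by (simp add: fder_def)
qed (auto simp: fder_def)

text \<open>A union of j - 1 pairs can be completed by one more pair in n - (j - 1) ways, and each
  contributes -j! = -j (j - 1)!.\<close>

lemma sum_fder_pair_power:
  shows "(\<Sum>i\<in>{1..n}. fder (2 * i - 1) (fder (2 * i) (pair_power n j)) A)
    = - of_nat (j * (n + 1 - j)) * pair_power n (j - 1) A"
proof -
  let ?I = "{i\<in>{1..n}. 2 * i - 1 \<notin> A \<and> 2 * i \<notin> A}"
  have "(\<Sum>i\<in>{1..n}. fder (2 * i - 1) (fder (2 * i) (pair_power n j)) A)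
    = (\<Sum>i\<in>{1..n}. if 2 * i - 1 \<notin> A \<and> 2 * i \<notin> A then - pair_power n j (A \<union> {2 * i - 1, 2 * i}) else 0)"
    by (intro sum.cong refl fder_pair) auto
  also have "\<dots> = (\<Sum>i\<in>?I. - pair_power n j (A \<union> {2 * i - 1, 2 * i}))"
    by (rule sum.inter_filter[symmetric]) simp
  also have "\<dots> = - of_nat (j * (n + 1 - j)) * pair_power n (j - 1) A"
  proof (cases "\<exists>S\<subseteq>{1..n}. A = pairs S")
    case True
    then obtain S where S: "S \<subseteq> {1..n}" "A = pairs S" by blast
    have fS: "finite S" using S finite_subset by blast
    have ind: "?I = {1..n} - S"
      using S(1) mem_pairs[OF S(1)] unfolding S(2) by (auto simp del: One_nat_def)
    have "pair_power n j (A \<union> {2 * i - 1, 2 * i}) = (if Suc (card S) = j then fact j else 0)"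
      if "i \<in> {1..n} - S" for i
    proof -
      have "A \<union> {2 * i - 1, 2 * i} = pairs (insert i S)" using S by (auto simp: pairs_insert)
      moreover have "insert i S \<subseteq> {1..n}" using S that by auto
      ultimately show ?thesis using that fS by (simp add: pair_power_pairs)
    qed
    then have "(\<Sum>i\<in>?I. - pair_power n j (A \<union> {2 * i - 1, 2 * i}))
        = - of_nat (card ({1..n} - S)) * (if Suc (card S) = j then fact j else 0)"
      unfolding ind by simp
    also have "card ({1..n} - S) = n - card S"
      using S fS by (simp add: card_Diff_subset)
    also have "- of_nat (n - card S) * (if Suc (card S) = j then fact j else 0)
        = - of_nat (j * (n + 1 - j)) * pair_power n (j - 1) A"
    proof (cases "j = Suc (card S)")
      case True
      then have j: "n + 1 - j = n - card S" "j - 1 = card S" by auto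
      show ?thesis unfolding j of_nat_mult
        by (simp add: S(2) pair_power_pairs[OF S(1)] True algebra_simps)
    next
      case False
      then show ?thesis using S by (cases j) (auto simp: pair_power_pairs)
    qed
    finally show ?thesis .
  next
    case False
    have "pair_power n j (A \<union> {2 * i - 1, 2 * i}) = 0" if i: "i \<in> ?I" for i
    proof (rule pair_power_eq_0)
      fix S assume S: "S \<subseteq> {1..n}"
      show "A \<union> {2 * i - 1, 2 * i} \<noteq> pairs S"
      proof
        assume eq: "A \<union> {2 * i - 1, 2 * i} = pairs S"
        then have "i \<in> S" using mem_pairs(1)[OF S, of i] i by auto
        then have "pairs (S - {i}) = pairs S - {2 * i - 1, 2 * i}" using pairs_remove S by simp
        also have "\<dots> = A" using i unfolding eq[symmetric] by auto
        finally show False using False S by blast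
      qed
    qed
    moreover have "pair_power n (j - 1) A = 0"
      using False by (intro pair_power_eq_0) auto
    ultimately show ?thesis by (simp add: sum.neutral)
  qed
  finally show ?thesis .
qed

section \<open>Test functions and the measure space\<close>

interpretation lborel_product: product_sigma_finite "\<lambda>_ :: nat. (lborel :: real measure)"
  by standard

lemma space_Rmeas [simp]: "space (Rmeas d) = Rspace d"
  by (simp add: Rmeas_def Rspace_def space_PiM)

lemma upd_in_Rspace: "x \<in> Rspace d \<Longrightarrow> i < d \<Longrightarrow> x(i := t) \<in> Rspace d"
  by (auto simp: Rspace_def PiE_def extensional_def)

lemma measurable_component_Rmeas: "i < d \<Longrightarrow> (\<lambda>x. x i) \<in> borel_measurable (Rmeas d)"
  unfolding Rmeas_def using measurable_component_singleton[of i "{..<d}" "\<lambda>_. lborel :: real measure"]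
  by simp

lemma rsq_measurable [measurable]: "rsq d \<in> borel_measurable (Rmeas d)"
  unfolding rsq_def[abs_def]
  by (intro borel_measurable_sum borel_measurable_power measurable_component_Rmeas) auto

lemma rsq_nonneg [simp]: "rsq d x \<ge> 0"
  by (simp add: rsq_def sum_nonneg)

lemma component_le_rsq: "i < d \<Longrightarrow> (x i)\<^sup>2 \<le> rsq d x"
  unfolding rsq_def by (rule member_le_sum) auto

text \<open>Links the product topology on all of \<open>nat \<Rightarrow> real\<close> to the finite
  product measure: on \<open>Rspace d\<close> the coordinates from d on are constantly
  \<open>undefined\<close>, so the inclusion is measurable coordinate by coordinate.\<close>

lemma continuous_on_imp_measurable_Rmeas:
  fixes g :: "(nat \<Rightarrow> real) \<Rightarrow> 'b::topological_space"
  assumes "continuous_on (Rspace d) g"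
  shows "g \<in> borel_measurable (Rmeas d)"
proof -
  have "(\<lambda>x. x) \<in> borel_measurable (Rmeas d)"
  proof (rule measurable_coordinatewise_then_product)
    fix i
    show "(\<lambda>x. x i) \<in> borel_measurable (Rmeas d)"
    proof (cases "i < d")
      case False
      then have "x i = undefined" if "x \<in> space (Rmeas d)" for x
        using that by (auto simp: Rspace_def PiE_def extensional_def)
      then show ?thesis by (subst measurable_cong[of _ _ "\<lambda>_. undefined"]) auto
    qed (rule measurable_component_Rmeas)
  qed
  then have "(\<lambda>x. x) \<in> measurable (Rmeas d) (restrict_space borel (Rspace d))"
    by (rule measurable_restrict_space2[rotated]) auto
  from measurable_compose[OF this borel_measurable_continuous_on_restrict[OF assms]]
  show ?thesis .
qed

section \<open>Null hyperplanes and local integrability of negative powers of r\<close>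

lemma AE_component_neq_0:
  assumes "i < d"
  shows "AE x in Rmeas d. x i \<noteq> 0"
proof (rule AE_I)
  let ?N = "PiE {..<d} (\<lambda>j. if j = i then {0 :: real} else UNIV)"
  show "{x \<in> space (Rmeas d). \<not> x i \<noteq> 0} \<subseteq> ?N"
    using assms by (auto simp: Rspace_def PiE_iff extensional_def)
  show "?N \<in> sets (Rmeas d)"
    unfolding Rmeas_def by (intro sets_PiM_I_finite) auto
  have "emeasure (Rmeas d) ?N = (\<Prod>j<d. emeasure lborel (if j = i then {0 :: real} else UNIV))"
    unfolding Rmeas_def by (intro lborel_product.emeasure_PiM) auto
  also have "\<dots> = 0"
    using assms by (intro prod_zero) auto
  finally show "emeasure (Rmeas d) ?N = 0" .
qed

text \<open>Removing all coordinate hyperplanes, not just the origin, is what the product majorant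
  below requires: its factors are negative powers of single coordinates, and \<open>0 powr p\<close>
  is 0.\<close>

lemma AE_components_neq_0: "AE x in Rmeas d. \<forall>i<d. x i \<noteq> 0"
proof -
  have "AE x in Rmeas d. \<forall>i\<in>{..<d}. x i \<noteq> 0"
    by (intro AE_finite_allI AE_component_neq_0) auto
  then show ?thesis by (simp add: Ball_def)
qed

lemma rsq_pos:
  assumes "\<forall>i<d. x i \<noteq> 0" "d \<ge> 1"
  shows "rsq d x > 0"
proof -
  have "0 < (x 0)\<^sup>2" using assms by auto
  also have "\<dots> \<le> rsq d x" using assms by (intro component_le_rsq) auto
  finally show ?thesis .
qed

text \<open>One factor of a product majorant for r^(-2a) on a ball of radius R. With p = 2a/d < 1
  each factor is integrable on the line, so local integrability follows without polar
  coordinates.\<close>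

definition box_weight :: "real \<Rightarrow> real \<Rightarrow> real \<Rightarrow> real" where
  "box_weight p R t = (if \<bar>t\<bar> \<le> R then \<bar>t\<bar> powr (- p) else 0)"

lemma integrable_box_weight:
  assumes "p < 1" "R \<ge> 0"
  shows "integrable lborel (box_weight p R)"
proof -
  define g where "g t = indicator {0..R} t * t powr (- p)" for t :: real
  have "g integrable_on UNIV"
  proof -
    have "((\<lambda>t. t powr (- p)) has_integral (R powr (- p + 1) / (- p + 1))) {0..R}"
      using assms by (intro has_integral_powr_from_0) auto
    then have "(g has_integral (R powr (- p + 1) / (- p + 1))) UNIV"
      unfolding g_def by (subst (asm) has_integral_restrict_UNIV[symmetric])
        (auto elim!: has_integral_eq[rotated])
    then show ?thesis by (auto simp: integrable_on_def)
  qed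
  moreover have "g \<in> borel_measurable borel" unfolding g_def[abs_def] by measurable
  ultimately have nn: "integral\<^sup>N lborel g = ennreal (integral UNIV g)"
    by (intro nn_integral_has_integral_lborel integrable_integral) (auto simp: g_def[abs_def])
  have g: "integrable lborel g"
  proof (rule integrableI_nonneg)
    show "g \<in> borel_measurable lborel" unfolding g_def[abs_def] by measurable
  qed (use nn in \<open>auto simp: g_def\<close>)
  have "integrable lborel (\<lambda>t. g t + g (0 + (-1) * t))"
    by (intro Bochner_Integration.integrable_add g lborel_integrable_real_affine) auto
  then show ?thesis
  proof (rule Bochner_Integration.integrable_bound)
    show "box_weight p R \<in> borel_measurable lborel"
      unfolding box_weight_def[abs_def] by measurable
    show "AE t in lborel. norm (box_weight p R t) \<le> norm (g t + g (0 + (-1) * t))"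
    proof (rule AE_I2)
      fix t :: real
      show "norm (box_weight p R t) \<le> norm (g t + g (0 + (-1) * t))"
        by (cases "t \<ge> 0") (auto simp: box_weight_def g_def indicator_def)
    qed
  qed
qed

lemma integrable_prod_box_weight:
  assumes "p < 1" "R \<ge> 0"
  shows "integrable (Rmeas d) (\<lambda>x. \<Prod>i<d. box_weight p R (x i))"
  unfolding Rmeas_def
  by (intro lborel_product.product_integrable_prod integrable_box_weight assms) auto

text \<open>The factors are estimated one by one by $(r^2)^{-a/d} \le (x_i^2)^{-a/d}$.\<close>

lemma rsq_powr_le_prod_box_weight:
  assumes x: "\<forall>i<d. x i \<noteq> 0" "rsq d x \<le> R\<^sup>2" and R: "R \<ge> 0" and d: "d \<ge> 1" and a: "a \<ge> 0"
  shows "rsq d x powr (- a) \<le> (\<Prod>i<d. box_weight (2 * a / real d) R (x i))"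
proof -
  have pos: "rsq d x > 0" using rsq_pos[OF x(1) d] .
  have "rsq d x powr (- a) = (\<Prod>i<d. rsq d x powr (- a / real d))"
    using pos d by (simp add: powr_power)
  also have "\<dots> \<le> (\<Prod>i<d. box_weight (2 * a / real d) R (x i))"
  proof (rule prod_mono, intro conjI)
    fix i assume "i \<in> {..<d}"
    then have i: "i < d" by simp
    have le: "(x i)\<^sup>2 \<le> rsq d x" by (rule component_le_rsq[OF i])
    have "\<bar>x i\<bar> \<le> R"
      using le x(2) R by (metis abs_le_square_iff abs_of_nonneg order_trans)
    have "rsq d x powr (- a / real d) \<le> ((x i)\<^sup>2) powr (- a / real d)"
      using i x(1) a le d by (intro powr_mono2') auto
    also have "(x i)\<^sup>2 = \<bar>x i\<bar> powr 2" by simp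
    also have "(\<bar>x i\<bar> powr 2) powr (- a / real d) = \<bar>x i\<bar> powr (- (2 * a / real d))"
      by (simp only: powr_powr) simp
    finally show "rsq d x powr (- a / real d) \<le> box_weight (2 * a / real d) R (x i)"
      using \<open>\<bar>x i\<bar> \<le> R\<close> by (simp add: box_weight_def)
  qed auto
  finally show ?thesis .
qed

text \<open>The support lies in a cube, which is compact by Tychonoff: the coordinates from d on are
  frozen to the single value \<open>undefined\<close>.\<close>

lemma bounded_support_bound:
  fixes g :: "(nat \<Rightarrow> real) \<Rightarrow> complex"
  assumes cont: "continuous_on (Rspace d) g" and supp: "\<And>x. x \<in> Rspace d \<Longrightarrow> rsq d x > K \<Longrightarrow> g x = 0"
  obtains B where "B \<ge> 0" "\<And>x. x \<in> Rspace d \<Longrightarrow> norm (g x) \<le> B"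
proof -
  define R where "R = sqrt (max K 0)"
  define C :: "(nat \<Rightarrow> real) set" where "C = PiE UNIV (\<lambda>i. if i < d then {-R..R} else {undefined})"
  have "compactin (product_topology (\<lambda>_ :: nat. euclidean :: real topology) UNIV) C"
    unfolding C_def by (subst compactin_PiE) auto
  then have "compact C"
    by (simp only: euclidean_product_topology compactin_euclidean_iff)
  moreover have CR: "C \<subseteq> Rspace d"
    by (auto simp: C_def Rspace_def PiE_def Pi_def extensional_def split: if_splits)
  ultimately have "compact (g ` C)"
    using cont by (intro compact_continuous_image) (auto intro: continuous_on_subset)
  then obtain B where B: "\<And>y. y \<in> g ` C \<Longrightarrow> norm y \<le> B"
    using compact_imp_bounded bounded_iff by metis
  have "norm (g x) \<le> max B 0" if x: "x \<in> Rspace d" for x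
  proof (cases "rsq d x > K")
    case False
    have "x \<in> C"
      unfolding C_def
    proof (rule PiE_I)
      fix i
      show "x i \<in> (if i < d then {-R..R} else {undefined})"
      proof (cases "i < d")
        case True
        have "(x i)\<^sup>2 \<le> max K 0" using component_le_rsq[OF True, of x] False by simp
        then have "\<bar>x i\<bar> \<le> R" unfolding R_def by (metis real_sqrt_abs real_sqrt_le_iff)
        then show ?thesis using True by auto
      qed (use x in \<open>auto simp: Rspace_def PiE_def extensional_def\<close>)
    qed simp
    then have "norm (g x) \<le> B" by (intro B) auto
    then show ?thesis by simp
  qed (use supp x in auto)
  then show ?thesis by (intro that[of "max B 0"]) auto
qed

lemma integrable_dominated_bounded_support:
  fixes f :: "(nat \<Rightarrow> real) \<Rightarrow> 'b::{banach, second_countable_topology}"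
  assumes f: "f \<in> borel_measurable (Rmeas d)"
    and bound: "\<And>x. x \<in> Rspace d \<Longrightarrow> \<forall>i<d. x i \<noteq> 0 \<Longrightarrow>
       norm (f x) \<le> (if rsq d x \<le> R\<^sup>2 then B * rsq d x powr (- a) else 0)"
    and "R \<ge> 0" "d \<ge> 1" "0 \<le> a" "2 * a < real d" "B \<ge> 0"
  shows "integrable (Rmeas d) f"
proof -
  have "integrable (Rmeas d) (\<lambda>x. B * (\<Prod>i<d. box_weight (2 * a / real d) R (x i)))"
    using assms by (intro integrable_mult_right integrable_prod_box_weight) auto
  then show ?thesis
  proof (rule Bochner_Integration.integrable_bound[OF _ f])
    show "AE x in Rmeas d. norm (f x) \<le> norm (B * (\<Prod>i<d. box_weight (2 * a / real d) R (x i)))"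
      using AE_components_neq_0
    proof (rule AE_mp, intro AE_I2 impI)
      fix x assume x: "x \<in> space (Rmeas d)" "\<forall>i<d. x i \<noteq> 0"
      have nn: "0 \<le> (\<Prod>i<d. box_weight (2 * a / real d) R (x i))"
        by (intro prod_nonneg) (auto simp: box_weight_def)
      have "norm (f x) \<le> B * (\<Prod>i<d. box_weight (2 * a / real d) R (x i))"
      proof (cases "rsq d x \<le> R\<^sup>2")
        case True
        then have "norm (f x) \<le> B * rsq d x powr (- a)" using bound[of x] x by simp
        also have "\<dots> \<le> B * (\<Prod>i<d. box_weight (2 * a / real d) R (x i))"
          using True x assms by (intro mult_left_mono rsq_powr_le_prod_box_weight) auto
        finally show ?thesis .
      qed (use bound[of x] x nn assms in auto)
      then show "norm (f x) \<le> norm (B * (\<Prod>i<d. box_weight (2 * a / real d) R (x i)))"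
        using nn assms by simp
    qed
  qed
qed

section \<open>Partial derivatives and stability of test functions\<close>

lemma rsq_upd: "i < d \<Longrightarrow> rsq d (x(i := t)) = rsq d x - (x i)\<^sup>2 + t\<^sup>2"
  unfolding rsq_def by (subst (1 2) sum.remove[of _ i]) (auto intro!: sum.cong)

lemma continuous_on_component [continuous_intros]: "continuous_on S (\<lambda>x :: nat \<Rightarrow> real. x i)"
  by (rule continuous_on_subset[OF continuous_on_product_coordinates]) auto

lemma continuous_on_rsq [continuous_intros]: "continuous_on S (rsq d)"
  unfolding rsq_def[abs_def] by (intro continuous_intros)

lemma ipd_append: "ipd (is @ js) g = ipd is (ipd js g)"
  by (induction "is") auto

lemma pdiff_eq:
  assumes "((\<lambda>t. g (x(i := x i + t))) has_vector_derivative g') (at 0)"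
  shows "pdiff i g x = g'"
  using assms unfolding pdiff_def by (rule vector_derivative_at)

text \<open>The region r^2 > K is open along coordinate lines, so differentiation does not enlarge
  the support and one K serves all derivatives.\<close>

lemma partial_derivative_vanishes:
  assumes "\<And>x. x \<in> Rspace d \<Longrightarrow> rsq d x > K \<Longrightarrow> g x = (0 :: complex)"
    and x: "x \<in> Rspace d" "rsq d x > K" "i < d"
    and der: "((\<lambda>t. g (x(i := x i + t))) has_vector_derivative g') (at 0)"
  shows "g' = 0"
proof -
  have "((\<lambda>t. rsq d x - (x i)\<^sup>2 + (x i + t)\<^sup>2) \<longlongrightarrow> rsq d x - (x i)\<^sup>2 + (x i + 0)\<^sup>2) (nhds 0)"
    by (intro tendsto_intros filterlim_ident)
  then have "((\<lambda>t. rsq d (x(i := x i + t))) \<longlongrightarrow> rsq d x) (nhds 0)"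
    using x by (simp add: rsq_upd)
  then have "\<forall>\<^sub>F t in nhds 0. rsq d (x(i := x i + t)) > K"
    using x by (simp add: order_tendstoD)
  then have "\<forall>\<^sub>F t in nhds 0. g (x(i := x i + t)) = 0"
    by (rule eventually_mono) (use assms upd_in_Rspace in auto)
  then have "((\<lambda>t. 0) has_vector_derivative g') (at 0)"
    using der by (subst (asm) has_vector_derivative_cong_ev[where g = "\<lambda>t. 0"])
      (auto dest: eventually_nhds_x_imp_x simp: eventually_mono)
  then show ?thesis
    using has_vector_derivative_const vector_derivative_unique_at by blast
qed

lemma test_fun_continuous: "test_fun d \<phi> \<Longrightarrow> set is \<subseteq> {..<d} \<Longrightarrow> continuous_on (Rspace d) (ipd is \<phi>)"
  unfolding test_fun_def by blast

lemma test_fun_deriv: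
  "test_fun d \<phi> \<Longrightarrow> set is \<subseteq> {..<d} \<Longrightarrow> i < d \<Longrightarrow> x \<in> Rspace d \<Longrightarrow>
    ((\<lambda>t. ipd is \<phi> (x(i := x i + t))) has_vector_derivative ipd (i # is) \<phi> x) (at 0)"
  unfolding test_fun_def by blast

lemma test_fun_support:
  assumes "test_fun d \<phi>"
  obtains K where "\<And>x. x \<in> Rspace d \<Longrightarrow> rsq d x > K \<Longrightarrow> \<phi> x = 0"
  using assms unfolding test_fun_def by blast

lemma test_fun_ipd:
  assumes \<phi>: "test_fun d \<phi>" and "set is \<subseteq> {..<d}"
  shows "test_fun d (ipd is \<phi>)"
proof -
  obtain K where K: "\<And>x. x \<in> Rspace d \<Longrightarrow> rsq d x > K \<Longrightarrow> \<phi> x = 0"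
    using test_fun_support[OF \<phi>] by blast
  have "ipd is \<phi> x = 0" if "x \<in> Rspace d" "rsq d x > K" for x
    using assms(2) that
  proof (induction "is" arbitrary: x)
    case (Cons i "is")
    then have i: "set is \<subseteq> {..<d}" "i < d" by auto
    show ?case
    proof (rule partial_derivative_vanishes)
      show "ipd is \<phi> y = 0" if "y \<in> Rspace d" "rsq d y > K" for y
        using Cons.IH i that by blast
    qed (use Cons.prems i test_fun_deriv[OF \<phi>] in blast)+
  qed (use K in auto)
  moreover have "continuous_on (Rspace d) (ipd js (ipd is \<phi>))" if "set js \<subseteq> {..<d}" for js
    unfolding ipd_append[symmetric] using that assms by (intro test_fun_continuous) auto
  moreover have "((\<lambda>t. ipd js (ipd is \<phi>) (x(i := x i + t))) has_vector_derivative
      ipd (i # js) (ipd is \<phi>) x) (at 0)" if "set js \<subseteq> {..<d}" "i < d" "x \<in> Rspace d" for js i x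
    using test_fun_deriv[OF \<phi>, of "js @ is" i x] that assms by (simp add: ipd_append)
  ultimately show ?thesis unfolding test_fun_def by blast
qed

lemma test_fun_sum:
  fixes \<phi> :: "'k \<Rightarrow> (nat \<Rightarrow> real) \<Rightarrow> complex"
  assumes I: "finite I" and \<phi>: "\<And>k. k \<in> I \<Longrightarrow> test_fun d (\<phi> k)"
  shows "test_fun d (\<lambda>x. \<Sum>k\<in>I. \<phi> k x)"
proof -
  let ?s = "\<lambda>x. \<Sum>k\<in>I. \<phi> k x"
  have deriv: "((\<lambda>t. \<Sum>k\<in>I. ipd is (\<phi> k) (x(i := x i + t))) has_vector_derivative
      (\<Sum>k\<in>I. ipd (i # is) (\<phi> k) x)) (at 0)"
    if "set is \<subseteq> {..<d}" "i < d" "x \<in> Rspace d" for "is" i x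
    using that \<phi> by (intro has_vector_derivative_sum test_fun_deriv[where d = d]) auto
  have eq: "ipd is ?s x = (\<Sum>k\<in>I. ipd is (\<phi> k) x)" if "set is \<subseteq> {..<d}" "x \<in> Rspace d" for "is" x
    using that
  proof (induction "is" arbitrary: x)
    case (Cons i "is")
    then have "(\<lambda>t. ipd is ?s (x(i := x i + t))) = (\<lambda>t. \<Sum>k\<in>I. ipd is (\<phi> k) (x(i := x i + t)))"
      by (intro ext Cons.IH upd_in_Rspace) auto
    then have "pdiff i (ipd is ?s) x = (\<Sum>k\<in>I. ipd (i # is) (\<phi> k) x)"
      using deriv[of "is" i x] Cons.prems by (intro pdiff_eq) auto
    then show ?case by simp
  qed simp
  have "continuous_on (Rspace d) (ipd is ?s)" if "set is \<subseteq> {..<d}" for "is"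
  proof -
    have "continuous_on (Rspace d) (\<lambda>x. \<Sum>k\<in>I. ipd is (\<phi> k) x)"
      using that by (intro continuous_on_sum test_fun_continuous \<phi>)
    then show ?thesis using eq[OF that] by (subst continuous_on_cong[OF refl]) auto
  qed
  moreover have "((\<lambda>t. ipd is ?s (x(i := x i + t))) has_vector_derivative ipd (i # is) ?s x) (at 0)"
    if that: "set is \<subseteq> {..<d}" "i < d" "x \<in> Rspace d" for "is" i x
  proof -
    have "(\<lambda>t. ipd is ?s (x(i := x i + t))) = (\<lambda>t. \<Sum>k\<in>I. ipd is (\<phi> k) (x(i := x i + t)))"
      using that by (intro ext eq upd_in_Rspace) auto
    moreover have "ipd (i # is) ?s x = (\<Sum>k\<in>I. ipd (i # is) (\<phi> k) x)"
      using that by (intro eq) auto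
    ultimately show ?thesis using deriv[OF that] by simp
  qed
  moreover have "\<exists>K. \<forall>x\<in>Rspace d. rsq d x > K \<longrightarrow> ?s x = 0"
  proof -
    have "\<forall>k\<in>I. \<exists>K. \<forall>x\<in>Rspace d. rsq d x > K \<longrightarrow> \<phi> k x = 0"
      using \<phi> unfolding test_fun_def by blast
    then obtain K where K: "\<And>k x. k \<in> I \<Longrightarrow> x \<in> Rspace d \<Longrightarrow> rsq d x > K k \<Longrightarrow> \<phi> k x = 0"
      by metis
    have "?s x = 0" if "x \<in> Rspace d" "rsq d x > (\<Sum>k\<in>I. \<bar>K k\<bar>)" for x
    proof (intro sum.neutral ballI K that)
      fix k assume "k \<in> I"
      then have "\<bar>K k\<bar> \<le> (\<Sum>k\<in>I. \<bar>K k\<bar>)" using I by (intro member_le_sum) auto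
      with that show "rsq d x > K k" by simp
    qed
    then show ?thesis by blast
  qed
  ultimately show ?thesis unfolding test_fun_def by blast
qed

lemma test_fun_blap: "test_fun d \<phi> \<Longrightarrow> test_fun d (blap d \<phi>)"
proof -
  assume \<phi>: "test_fun d \<phi>"
  have "blap d \<phi> = (\<lambda>x. \<Sum>i\<in>{..<d}. ipd [i, i] \<phi> x)"
    by (simp add: blap_def[abs_def])
  then show ?thesis
    using \<phi> by (simp only:) (intro test_fun_sum test_fun_ipd, auto)
qed

lemma test_fun_funpow_blap: "test_fun d \<phi> \<Longrightarrow> test_fun d ((blap d ^^ j) \<phi>)"
  by (induction j) (auto intro: test_fun_blap)

lemma test_fun_bounded_support:
  assumes "test_fun d \<phi>"
  obtains B R where "B \<ge> 0" "R \<ge> 0"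
    "\<And>x. x \<in> Rspace d \<Longrightarrow> norm (\<phi> x) \<le> (if rsq d x \<le> R\<^sup>2 then B else 0)"
proof -
  obtain K where K: "\<And>x. x \<in> Rspace d \<Longrightarrow> rsq d x > K \<Longrightarrow> \<phi> x = 0"
    using test_fun_support[OF assms] by blast
  obtain B where B: "B \<ge> 0" "\<And>x. x \<in> Rspace d \<Longrightarrow> norm (\<phi> x) \<le> B"
    using bounded_support_bound[of d \<phi> K] test_fun_continuous[OF assms, of "[]"] K by auto
  show ?thesis
    by (rule that[of B "sqrt (max K 0)"]) (use K B in auto)
qed

lemma test_fun_measurable: "test_fun d \<phi> \<Longrightarrow> \<phi> \<in> borel_measurable (Rmeas d)"
  using test_fun_continuous[of d \<phi> "[]"] by (auto intro: continuous_on_imp_measurable_Rmeas)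

section \<open>Integration by parts against smooth radial functions\<close>

lemma integrable_continuous_bounded_support:
  fixes g :: "(nat \<Rightarrow> real) \<Rightarrow> complex"
  assumes cont: "continuous_on (Rspace d) g" and supp: "\<And>x. x \<in> Rspace d \<Longrightarrow> rsq d x > K \<Longrightarrow> g x = 0"
    and d: "d \<ge> 1"
  shows "integrable (Rmeas d) g"
proof -
  obtain B where B: "B \<ge> 0" "\<And>x. x \<in> Rspace d \<Longrightarrow> norm (g x) \<le> B"
    using bounded_support_bound[OF cont supp] by metis
  show ?thesis
  proof (rule integrable_dominated_bounded_support[where R = "sqrt (max K 0)" and B = B and a = 0])
    fix x assume x: "x \<in> Rspace d" "\<forall>i<d. x i \<noteq> 0"
    show "norm (g x) \<le> (if rsq d x \<le> (sqrt (max K 0))\<^sup>2 then B * rsq d x powr - 0 else 0)"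
      using rsq_pos[OF x(2) d] B(2)[OF x(1)] supp[OF x(1)] by auto
  qed (use B d cont in \<open>auto intro: continuous_on_imp_measurable_Rmeas\<close>)
qed

text \<open>Fubini isolates the i-th coordinate, and the fundamental theorem of calculus on an
  interval ending outside the support makes the inner integral vanish.\<close>

lemma integral_partial_derivative_eq_0:
  fixes u v :: "(nat \<Rightarrow> real) \<Rightarrow> complex"
  assumes i: "i < d"
    and der: "\<And>x. x \<in> Rspace d \<Longrightarrow> ((\<lambda>t. u (x(i := x i + t))) has_vector_derivative v x) (at 0)"
    and cont: "continuous_on (Rspace d) v"
    and supp: "\<And>x. x \<in> Rspace d \<Longrightarrow> rsq d x > K \<Longrightarrow> u x = 0"
  shows "integral\<^sup>L (Rmeas d) v = 0"
proof -
  have supp_v: "v x = 0" if "x \<in> Rspace d" "rsq d x > K" for x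
    using partial_derivative_vanishes[of d K u x i "v x"] supp der that i by blast
  have int: "integrable (Rmeas d) v"
    using i by (intro integrable_continuous_bounded_support[OF cont supp_v]) auto
  define I where "I = {..<d} - {i}"
  have I: "insert i I = {..<d}" "i \<notin> I" "finite I" using i by (auto simp: I_def)
  \<comment> \<open>The summand 1 makes R^2 > K strict, so that u vanishes at the end points
    themselves.\<close>
  define R where "R = sqrt (max K 0) + 1"
  have R: "R > 0" "R\<^sup>2 > K"
  proof -
    have "K \<le> (sqrt (max K 0))\<^sup>2" by simp
    also have "\<dots> < R\<^sup>2" unfolding R_def by (intro power_strict_mono) auto
    finally show "R\<^sup>2 > K" .
  qed (simp add: R_def add_nonneg_pos)
  have inner: "(\<integral>t. v (x(i := t)) \<partial>lborel) = 0" if x: "x \<in> space (PiM I (\<lambda>_. lborel))" for x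
  proof -
    have mem: "x(i := t) \<in> Rspace d" for t
      using x I i by (auto simp: space_PiM Rspace_def PiE_iff extensional_def)
    have "rsq d (x(i := t)) > K" if "\<bar>t\<bar> \<ge> R" for t
    proof -
      have "R\<^sup>2 \<le> t\<^sup>2" using that R by (metis abs_le_square_iff abs_of_pos)
      also have "\<dots> \<le> rsq d (x(i := t))" using component_le_rsq[OF i, of "x(i := t)"] by simp
      finally show ?thesis using R by simp
    qed
    then have z: "u (x(i := t)) = 0" "v (x(i := t)) = 0" if "\<bar>t\<bar> \<ge> R" for t
      using that supp supp_v mem by auto
    have D: "((\<lambda>t. u (x(i := t))) has_vector_derivative v (x(i := t))) (at t within S)" for t S
    proof -
      have "((\<lambda>h. u (x(i := t + h))) has_vector_derivative v (x(i := t))) (at (t - t))"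
        using der[OF mem[of t]] by simp
      then have "((\<lambda>s. u (x(i := t + (s - t)))) has_vector_derivative (1 *\<^sub>R v (x(i := t)))) (at t)"
        by (intro vector_diff_chain_at[unfolded o_def, where f = "\<lambda>s. s - t" and g = "\<lambda>h. u (x(i := t + h))"])
           (auto intro!: derivative_eq_intros)
      then show ?thesis by (auto intro: has_vector_derivative_at_within)
    qed
    have c: "continuous_on {-R..R} (\<lambda>t. v (x(i := t)))"
    proof (rule continuous_on_compose2[OF cont])
      show "continuous_on {-R..R} (\<lambda>t. x(i := t))"
      proof (rule continuous_on_coordinatewise_then_product)
        show "continuous_on {-R..R} (\<lambda>t. (x(i := t)) j)" for j
          by (cases "j = i") (auto intro: continuous_intros)
      qed
    qed (use mem in auto)
    have "(\<integral>t. v (x(i := t)) \<partial>lborel) = (\<integral>t. indicator {-R..R} t *\<^sub>R v (x(i := t)) \<partial>lborel)"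
      using z by (intro Bochner_Integration.integral_cong refl) (auto simp: indicator_def abs_if)
    also have "\<dots> = u (x(i := R)) - u (x(i := -R))"
      using R by (intro integral_FTC_Icc D c) auto
    also have "\<dots> = 0" using z R by auto
    finally show ?thesis .
  qed
  have "integral\<^sup>L (Rmeas d) v = (\<integral>x. (\<integral>t. v (x(i := t)) \<partial>lborel) \<partial>PiM I (\<lambda>_. lborel))"
    using lborel_product.product_integral_insert[OF I(3,2), of v] int I by (simp add: Rmeas_def)
  also have "\<dots> = (\<integral>x. 0 \<partial>PiM I (\<lambda>_ :: nat. lborel :: real measure))"
    using inner by (intro Bochner_Integration.integral_cong refl) auto
  finally show ?thesis by simp
qed

text \<open>Green's identity for G(x) = g0(r^2). The function w_i below is the i-th partial
  derivative of G \<partial>_i \<phi> - \<phi> \<partial>_i G, where \<partial>_i G = 2 x_i g1(r^2);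
  the mixed terms cancel and each w_i integrates to zero. Differentiability is demanded at s = 0 as
  well, which the shift by \<epsilon> will provide.\<close>

lemma integral_radial_blap:
  fixes g0 g1 g2 :: "real \<Rightarrow> real"
  assumes \<phi>: "test_fun d \<phi>" and d: "d \<ge> 1"
    and g0: "\<And>s. s \<ge> 0 \<Longrightarrow> (g0 has_real_derivative g1 s) (at s)"
    and g1: "\<And>s. s \<ge> 0 \<Longrightarrow> (g1 has_real_derivative g2 s) (at s)"
    and g2: "continuous_on {0..} g2"
  shows "(\<integral>x. of_real (g0 (rsq d x)) * blap d \<phi> x \<partial>Rmeas d) =
    (\<integral>x. of_real (4 * rsq d x * g2 (rsq d x) + 2 * real d * g1 (rsq d x)) * \<phi> x \<partial>Rmeas d)"
proof -
  obtain K where K: "\<And>x. x \<in> Rspace d \<Longrightarrow> rsq d x > K \<Longrightarrow> \<phi> x = 0"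
    using test_fun_support[OF \<phi>] by blast
  have c0: "continuous_on {0..} g0" "continuous_on {0..} g1"
    by (rule DERIV_continuous_on[where D = g1], use g0 in \<open>simp add: has_field_derivative_at_within\<close>)
      (rule DERIV_continuous_on[where D = g2], use g1 in \<open>simp add: has_field_derivative_at_within\<close>)
  have cr: "continuous_on (Rspace d) (\<lambda>x. h (rsq d x))" if "continuous_on {0..} h" for h :: "real \<Rightarrow> real"
    by (rule continuous_on_compose2[OF that]) (auto intro: continuous_on_rsq)
  have c\<phi>: "continuous_on (Rspace d) \<phi>" using test_fun_continuous[OF \<phi>, of "[]"] by simp
  have c2: "continuous_on (Rspace d) (\<lambda>x. pdiff i (pdiff i \<phi>) x)" if "i < d" for i
    using test_fun_continuous[OF \<phi>, of "[i, i]"] that by simp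
  define w where "w i x = g0 (rsq d x) *\<^sub>R pdiff i (pdiff i \<phi>) x
      - (2 * g1 (rsq d x) + 4 * (x i)\<^sup>2 * g2 (rsq d x)) *\<^sub>R \<phi> x" for i x
  have cw: "continuous_on (Rspace d) (w i)" if "i < d" for i
    unfolding w_def[abs_def] using c2[OF that]
    by (intro continuous_intros cr c0 g2 c\<phi>) auto
  have sw: "w i x = 0" if "i < d" "x \<in> Rspace d" "rsq d x > K" for i x
  proof -
    have "pdiff i \<phi> y = 0" if "y \<in> Rspace d" "rsq d y > K" for y
      using partial_derivative_vanishes[OF K that \<open>i < d\<close>] test_fun_deriv[OF \<phi>, of "[]" i y]
        that \<open>i < d\<close> by simp
    then have "pdiff i (pdiff i \<phi>) x = 0"
      using partial_derivative_vanishes[of d K "pdiff i \<phi>" x i] test_fun_deriv[OF \<phi>, of "[i]" i x]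
        that by simp
    then show ?thesis using K that by (simp add: w_def)
  qed
  have iw: "integral\<^sup>L (Rmeas d) (w i) = 0" if i: "i < d" for i
  proof (rule integral_partial_derivative_eq_0[OF i _ cw[OF i], where K = K])
    fix x assume x: "x \<in> Rspace d"
    let ?y = "\<lambda>t. x(i := x i + t)"
    have dr: "((\<lambda>t. rsq d (?y t)) has_real_derivative 2 * x i) (at 0)"
      unfolding rsq_upd[OF i] by (auto intro!: derivative_eq_intros)
    have d0: "((\<lambda>t. g0 (rsq d (?y t))) has_real_derivative g1 (rsq d x) * (2 * x i)) (at 0)"
      using g0[of "rsq d x"] by (intro DERIV_chain2[OF _ dr]) auto
    have d1: "((\<lambda>t. g1 (rsq d (?y t))) has_real_derivative g2 (rsq d x) * (2 * x i)) (at 0)"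
      using g1[of "rsq d x"] by (intro DERIV_chain2[OF _ dr]) auto
    have d1': "((\<lambda>t. 2 * (x i + t) * g1 (rsq d (?y t))) has_real_derivative
        2 * g1 (rsq d x) + 4 * (x i)\<^sup>2 * g2 (rsq d x)) (at 0)"
      by (rule derivative_eq_intros d1 refl | simp add: power2_eq_square)+
    have p0: "((\<lambda>t. \<phi> (?y t)) has_vector_derivative pdiff i \<phi> x) (at 0)"
      using test_fun_deriv[OF \<phi>, of "[]" i x] i x by simp
    have p1: "((\<lambda>t. pdiff i \<phi> (?y t)) has_vector_derivative pdiff i (pdiff i \<phi>) x) (at 0)"
      using test_fun_deriv[OF \<phi>, of "[i]" i x] i x by simp
    have "((\<lambda>t. g0 (rsq d (?y t)) *\<^sub>R pdiff i \<phi> (?y t) - (2 * (x i + t) * g1 (rsq d (?y t))) *\<^sub>R \<phi> (?y t))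
      has_vector_derivative w i x) (at 0)"
      using has_vector_derivative_diff[OF has_vector_derivative_scaleR[OF d0 p1]
          has_vector_derivative_scaleR[OF d1' p0]]
      by (simp add: w_def algebra_simps)
    then show "((\<lambda>t. (\<lambda>x. g0 (rsq d x) *\<^sub>R pdiff i \<phi> x - (2 * x i * g1 (rsq d x)) *\<^sub>R \<phi> x) (?y t))
      has_vector_derivative w i x) (at 0)"
      by simp
  next
    fix x assume x: "x \<in> Rspace d" "rsq d x > K"
    have "pdiff i \<phi> x = 0"
      using partial_derivative_vanishes[OF K x i] test_fun_deriv[OF \<phi>, of "[]" i x] x i by simp
    then show "g0 (rsq d x) *\<^sub>R pdiff i \<phi> x - (2 * x i * g1 (rsq d x)) *\<^sub>R \<phi> x = 0"
      using K[OF x] by simp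
  qed
  define G where "G x = complex_of_real (g0 (rsq d x)) * blap d \<phi> x" for x
  define H where "H x = complex_of_real (4 * rsq d x * g2 (rsq d x) + 2 * real d * g1 (rsq d x)) * \<phi> x" for x
  have sum_w: "(\<Sum>i<d. w i x) = G x - H x" for x
  proof -
    have "(\<Sum>i<d. w i x) = g0 (rsq d x) *\<^sub>R blap d \<phi> x
        - (\<Sum>i<d. 2 * g1 (rsq d x) + 4 * (x i)\<^sup>2 * g2 (rsq d x)) *\<^sub>R \<phi> x"
      by (simp add: w_def sum_subtractf blap_def scaleR_sum_right scaleR_sum_left)
    also have "(\<Sum>i<d. 2 * g1 (rsq d x) + 4 * (x i)\<^sup>2 * g2 (rsq d x))
        = 4 * rsq d x * g2 (rsq d x) + 2 * real d * g1 (rsq d x)"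
      by (simp add: sum.distrib rsq_def sum_distrib_left sum_distrib_right)
    finally show ?thesis by (simp add: G_def H_def scaleR_conv_of_real)
  qed
  have iH: "integrable (Rmeas d) H"
    unfolding H_def[abs_def] using K d c0 g2 c\<phi>
    by (intro integrable_continuous_bounded_support[where K = K])
       (auto intro!: continuous_intros cr)
  have isum: "integrable (Rmeas d) (\<lambda>x. \<Sum>i<d. w i x)"
    using cw sw d by (intro Bochner_Integration.integrable_sum integrable_continuous_bounded_support) auto
  have "integral\<^sup>L (Rmeas d) G = (\<integral>x. (\<Sum>i<d. w i x) + H x \<partial>Rmeas d)"
    by (simp add: sum_w)
  also have "\<dots> = (\<integral>x. (\<Sum>i<d. w i x) \<partial>Rmeas d) + integral\<^sup>L (Rmeas d) H"
    using isum iH by (intro Bochner_Integration.integral_add)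
  also have "(\<integral>x. (\<Sum>i<d. w i x) \<partial>Rmeas d) = (\<Sum>i<d. integral\<^sup>L (Rmeas d) (w i))"
    using cw sw d by (intro Bochner_Integration.integral_sum integrable_continuous_bounded_support) auto
  also have "\<dots> = 0" using iw by simp
  finally show ?thesis by (simp add: G_def H_def)
qed

section \<open>The radial kernel\<close>

lemma nn_integral_Gamma_scaled:
  assumes "a > 0" "c > 0"
  shows "(\<integral>\<^sup>+t. ennreal (indicator {0..} t * t powr (a - 1) * exp (- c * t)) \<partial>lborel)
    = ennreal (Gamma a * c powr (- a))"
proof -
  let ?f = "\<lambda>t :: real. indicator {0..} t * t powr (a - 1) * exp (- c * t)"
  have "ennreal (Gamma a) = (\<integral>\<^sup>+t. ennreal (indicator {0..} t * t powr (a - 1) / exp t) \<partial>lborel)"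
    using Gamma_conv_nn_integral_real[OF assms(1)] .
  also have "\<dots> = ennreal \<bar>c\<bar> * (\<integral>\<^sup>+t. ennreal (indicator {0..} (0 + c * t) * (0 + c * t) powr (a - 1)
      / exp (0 + c * t)) \<partial>lborel)"
    using assms by (intro nn_integral_real_affine) auto
  also have "(\<integral>\<^sup>+t. ennreal (indicator {0..} (0 + c * t) * (0 + c * t) powr (a - 1) / exp (0 + c * t)) \<partial>lborel)
    = (\<integral>\<^sup>+t. ennreal (c powr (a - 1)) * ennreal (?f t) \<partial>lborel)"
    using assms
    by (intro nn_integral_cong, subst ennreal_mult[symmetric])
       (auto simp: indicator_def powr_mult exp_minus field_simps zero_le_mult_iff)
  also have "\<dots> = ennreal (c powr (a - 1)) * (\<integral>\<^sup>+t. ennreal (?f t) \<partial>lborel)"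
    by (rule nn_integral_cmult) measurable
  finally have "ennreal (Gamma a) = ennreal (c powr a) * (\<integral>\<^sup>+t. ennreal (?f t) \<partial>lborel)"
    using assms by (simp add: mult.assoc[symmetric] ennreal_mult'[symmetric] powr_mult_base)
  then have "ennreal (c powr (- a)) * ennreal (Gamma a)
      = ennreal (c powr (- a)) * (ennreal (c powr a) * (\<integral>\<^sup>+t. ennreal (?f t) \<partial>lborel))"
    by simp
  also have "\<dots> = (\<integral>\<^sup>+t. ennreal (?f t) \<partial>lborel)"
    using assms by (simp add: mult.assoc[symmetric] ennreal_mult'[symmetric] powr_add[symmetric])
  finally have "(\<integral>\<^sup>+t. ennreal (?f t) \<partial>lborel) = ennreal (c powr (- a)) * ennreal (Gamma a)" ..
  also have "\<dots> = ennreal (Gamma a * c powr (- a))"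
    by (subst ennreal_mult'[symmetric]) (simp_all add: mult.commute)
  finally show ?thesis .
qed

lemma nn_integral_gaussian:
  assumes "t > 0"
  shows "(\<integral>\<^sup>+x. ennreal (exp (- t * x\<^sup>2)) \<partial>lborel) = ennreal (sqrt (pi / t))"
proof -
  \<comment> \<open>Variance 1/(2t), so that the exponent of the normal density is -t x^2.\<close>
  define \<sigma> where "\<sigma> = 1 / sqrt (2 * t)"
  have \<sigma>: "\<sigma> > 0" "\<sigma>\<^sup>2 = 1 / (2 * t)" using assms by (simp_all add: \<sigma>_def power_divide)
  have dens: "exp (- t * x\<^sup>2) = sqrt (pi / t) * normal_density 0 \<sigma> x" for x
    using assms unfolding normal_density_def \<sigma>(2) by (simp add: real_sqrt_divide field_simps)
  have "(\<integral>\<^sup>+x. ennreal (exp (- t * x\<^sup>2)) \<partial>lborel)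
    = (\<integral>\<^sup>+x. ennreal (sqrt (pi / t)) * ennreal (normal_density 0 \<sigma> x) \<partial>lborel)"
    using assms by (simp only: dens) (simp add: ennreal_mult')
  also have "\<dots> = ennreal (sqrt (pi / t)) * (\<integral>\<^sup>+x. ennreal (normal_density 0 \<sigma> x) \<partial>lborel)"
    by (rule nn_integral_cmult) measurable
  also have "(\<integral>\<^sup>+x. ennreal (normal_density 0 \<sigma> x) \<partial>lborel) = ennreal 1"
    using \<sigma> by (subst nn_integral_eq_integral) auto
  finally show ?thesis by simp
qed

lemma nn_integral_gaussian_rsq:
  assumes "t > 0"
  shows "(\<integral>\<^sup>+x. ennreal (exp (- t * rsq d x)) \<partial>Rmeas d) = ennreal ((pi / t) powr (real d / 2))"
proof -
  have "(\<integral>\<^sup>+x. ennreal (exp (- t * rsq d x)) \<partial>Rmeas d)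
    = (\<integral>\<^sup>+x. (\<Prod>i<d. ennreal (exp (- t * (x i)\<^sup>2))) \<partial>Rmeas d)"
    by (intro nn_integral_cong) (simp add: rsq_def sum_distrib_left exp_sum prod_ennreal flip: sum_negf)
  also have "\<dots> = (\<Prod>i<d. \<integral>\<^sup>+x. ennreal (exp (- t * x\<^sup>2)) \<partial>lborel)"
    unfolding Rmeas_def by (intro lborel_product.product_nn_integral_prod) auto
  also have "\<dots> = ennreal (sqrt (pi / t) ^ d)"
    by (simp only: nn_integral_gaussian[OF assms] prod_constant card_lessThan ennreal_power
        real_sqrt_ge_zero divide_nonneg_pos assms pi_ge_zero)
  also have "sqrt (pi / t) ^ d = (pi / t) powr (real d / 2)"
    using assms by (simp add: powr_half_sqrt[symmetric] powr_power)
  finally show ?thesis .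
qed

text \<open>Tonelli applied to $\Gamma(a) (r^2+e)^{-a} = \int_0^\infty t^{a-1} e^{-t(r^2+e)}\,dt$.\<close>

lemma nn_integral_kernel:
  assumes a: "a > real d / 2" and e: "e > 0"
  shows "(\<integral>\<^sup>+x. ennreal ((rsq d x + e) powr (- a)) \<partial>Rmeas d)
    = ennreal (pi powr (real d / 2) * Gamma (a - real d / 2) / Gamma a * e powr (real d / 2 - a))"
proof -
  have a0: "a > 0" using a by (simp add: order.strict_trans1[of 0 "real d / 2"])
  define f where "f t x = ennreal (indicator {0..} t * t powr (a - 1) * exp (- (rsq d x + e) * t))" for t x
  interpret R: sigma_finite_measure "Rmeas d"
    unfolding Rmeas_def by (rule lborel_product.sigma_finite) simp
  interpret P: pair_sigma_finite "lborel :: real measure" "Rmeas d" ..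
  have [measurable]: "(\<lambda>(t, x). f t x) \<in> borel_measurable (lborel \<Otimes>\<^sub>M Rmeas d)"
    unfolding f_def by measurable
  have G0: "Gamma a > 0" using a0 by (simp add: Gamma_real_pos)
  have "ennreal (Gamma a) * (\<integral>\<^sup>+x. ennreal ((rsq d x + e) powr (- a)) \<partial>Rmeas d)
    = (\<integral>\<^sup>+x. ennreal (Gamma a) * ennreal ((rsq d x + e) powr (- a)) \<partial>Rmeas d)"
    by (rule nn_integral_cmult[symmetric]) measurable
  also have "\<dots> = (\<integral>\<^sup>+x. \<integral>\<^sup>+t. f t x \<partial>lborel \<partial>Rmeas d)"
  proof (rule nn_integral_cong)
    fix x
    have "rsq d x + e > 0" using e by (simp add: add_nonneg_pos)
    then show "ennreal (Gamma a) * ennreal ((rsq d x + e) powr (- a)) = (\<integral>\<^sup>+t. f t x \<partial>lborel)"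
      unfolding f_def using G0 by (subst nn_integral_Gamma_scaled[OF a0]) (auto simp: ennreal_mult')
  qed
  also have "\<dots> = (\<integral>\<^sup>+t. \<integral>\<^sup>+x. f t x \<partial>Rmeas d \<partial>lborel)"
    by (rule P.Fubini') measurable
  also have "\<dots> = (\<integral>\<^sup>+t. ennreal (pi powr (real d / 2)) *
      ennreal (indicator {0..} t * t powr (a - real d / 2 - 1) * exp (- e * t)) \<partial>lborel)"
  proof (rule nn_integral_cong_AE)
    have "AE t in lborel. t \<noteq> (0 :: real)" by (rule AE_lborel_singleton)
    then show "AE t in lborel. (\<integral>\<^sup>+x. f t x \<partial>Rmeas d) = ennreal (pi powr (real d / 2)) *
      ennreal (indicator {0..} t * t powr (a - real d / 2 - 1) * exp (- e * t))"
    proof (rule AE_mp, intro AE_I2 impI)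
      fix t :: real assume "t \<noteq> 0"
      show "(\<integral>\<^sup>+x. f t x \<partial>Rmeas d) = ennreal (pi powr (real d / 2)) *
        ennreal (indicator {0..} t * t powr (a - real d / 2 - 1) * exp (- e * t))"
      proof (cases "t > 0")
        case True
        have "(\<integral>\<^sup>+x. f t x \<partial>Rmeas d)
          = (\<integral>\<^sup>+x. ennreal (t powr (a - 1) * exp (- e * t)) * ennreal (exp (- t * rsq d x)) \<partial>Rmeas d)"
          using True unfolding f_def
          by (intro nn_integral_cong, subst ennreal_mult'[symmetric]) (auto simp: exp_add[symmetric] algebra_simps)
        also have "\<dots> = ennreal (t powr (a - 1) * exp (- e * t)) * ennreal ((pi / t) powr (real d / 2))"
          by (subst nn_integral_cmult) (measurable, simp only: nn_integral_gaussian_rsq[OF True])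
        also have "\<dots> = ennreal (pi powr (real d / 2) * (t powr (a - real d / 2 - 1) * exp (- e * t)))"
        proof -
          have "t powr (a - real d / 2 - 1) = t powr (a - 1) * t powr (- (real d / 2))"
            using True by (simp add: powr_add[symmetric] algebra_simps)
          then have "t powr (a - 1) * exp (- e * t) * (pi / t) powr (real d / 2)
            = pi powr (real d / 2) * (t powr (a - real d / 2 - 1) * exp (- e * t))"
            using True by (simp add: powr_divide powr_minus field_simps)
          then show ?thesis using True by (subst ennreal_mult'[symmetric]) auto
        qed
        finally show ?thesis using True by (simp add: ennreal_mult')
      next
        case False
        then show ?thesis using \<open>t \<noteq> 0\<close> by (simp add: f_def)
      qed
    qed
  qed
  also have "\<dots> = ennreal (pi powr (real d / 2)) *
      (\<integral>\<^sup>+t. ennreal (indicator {0..} t * t powr (a - real d / 2 - 1) * exp (- e * t)) \<partial>lborel)"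
    by (rule nn_integral_cmult) measurable
  also have "\<dots> = ennreal (pi powr (real d / 2) * (Gamma (a - real d / 2) * e powr (real d / 2 - a)))"
    using a e by (subst nn_integral_Gamma_scaled) (auto simp: ennreal_mult')
  finally have eq: "ennreal (Gamma a) * (\<integral>\<^sup>+x. ennreal ((rsq d x + e) powr (- a)) \<partial>Rmeas d)
    = ennreal (pi powr (real d / 2) * (Gamma (a - real d / 2) * e powr (real d / 2 - a)))" .
  have "(\<integral>\<^sup>+x. ennreal ((rsq d x + e) powr (- a)) \<partial>Rmeas d)
    = ennreal (1 / Gamma a) * (ennreal (Gamma a) * (\<integral>\<^sup>+x. ennreal ((rsq d x + e) powr (- a)) \<partial>Rmeas d))"
    using G0 by (simp add: mult.assoc[symmetric] ennreal_mult'[symmetric])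
  also have "\<dots> = ennreal (pi powr (real d / 2) * Gamma (a - real d / 2) / Gamma a * e powr (real d / 2 - a))"
    unfolding eq using G0 by (subst ennreal_mult'[symmetric]) (auto simp: mult.assoc)
  finally show ?thesis .
qed

lemma has_bochner_integral_kernel:
  assumes "a > real d / 2" "e > 0"
  shows "has_bochner_integral (Rmeas d) (\<lambda>x. (rsq d x + e) powr (- a))
    (pi powr (real d / 2) * Gamma (a - real d / 2) / Gamma a * e powr (real d / 2 - a))"
proof (rule has_bochner_integral_nn_integral)
  have "a > 0" using assms by (simp add: order.strict_trans1[of 0 "real d / 2"])
  then show "0 \<le> pi powr (real d / 2) * Gamma (a - real d / 2) / Gamma a * e powr (real d / 2 - a)"
    using assms by (intro mult_nonneg_nonneg divide_nonneg_nonneg less_imp_le[OF Gamma_real_pos]) auto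
qed (use nn_integral_kernel[OF assms] in auto)

section \<open>Concentration at the origin\<close>

lemma origin_in_Rspace: "origin d \<in> Rspace d"
  by (auto simp: origin_def Rspace_def)

text \<open>Expresses continuity in the product topology through r^2. Otherwise there would be
  points with r^2 < 1/(k + 1) violating the bound, and these converge coordinatewise to the
  origin.\<close>

lemma continuous_near_origin:
  fixes g :: "(nat \<Rightarrow> real) \<Rightarrow> complex"
  assumes cont: "continuous_on (Rspace d) g" and "\<eta> > 0"
  obtains \<delta> where "\<delta> > 0" "\<And>x. x \<in> Rspace d \<Longrightarrow> rsq d x < \<delta> \<Longrightarrow> norm (g x - g (origin d)) < \<eta>"
proof (rule ccontr)
  assume "\<not> thesis"
  then have "\<forall>k. \<exists>x. x \<in> Rspace d \<and> rsq d x < 1 / real (Suc k) \<and> norm (g x - g (origin d)) \<ge> \<eta>"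
    using that by (metis not_less of_nat_0_less_iff zero_less_Suc zero_less_divide_1_iff)
  then obtain X where X: "\<And>k. X k \<in> Rspace d" "\<And>k. rsq d (X k) < 1 / real (Suc k)"
      "\<And>k. norm (g (X k) - g (origin d)) \<ge> \<eta>"
    by metis
  have "(\<lambda>k. X k i) \<longlonglongrightarrow> origin d i" for i
  proof (cases "i < d")
    case True
    have "(\<lambda>k. (X k i)\<^sup>2) \<longlonglongrightarrow> 0"
    proof (rule tendsto_sandwich[OF _ _ tendsto_const LIMSEQ_inverse_real_of_nat])
      show "\<forall>\<^sub>F k in sequentially. (X k i)\<^sup>2 \<le> inverse (real (Suc k))"
        using component_le_rsq[OF True] X(2)
        by (intro always_eventually allI) (metis inverse_eq_divide less_imp_le order_trans)
    qed auto
    then show ?thesis using True by (simp add: origin_def)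
  next
    case False
    then have "X k i = undefined" for k using X(1)[of k] by (auto simp: Rspace_def PiE_def extensional_def)
    then show ?thesis using False by (simp add: origin_def)
  qed
  then have "limitin (product_topology (\<lambda>_. euclidean) UNIV) X (origin d) sequentially"
    by (subst limitin_componentwise) auto
  then have "X \<longlonglongrightarrow> origin d"
    by (simp only: euclidean_product_topology limitin_canonical_iff)
  then have "(\<lambda>k. g (X k)) \<longlonglongrightarrow> g (origin d)"
    using X(1) by (intro continuous_on_tendsto_compose[OF cont] origin_in_Rspace) auto
  then have "(\<lambda>k. norm (g (X k) - g (origin d))) \<longlonglongrightarrow> 0"
    by (simp add: tendsto_norm_zero_iff LIM_zero_iff)
  then have "\<forall>\<^sub>F k in sequentially. norm (g (X k) - g (origin d)) < \<eta>"
    using \<open>\<eta> > 0\<close> by (simp add: order_tendstoD)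
  then obtain k where "norm (g (X k) - g (origin d)) < \<eta>"
    using eventually_happens'[OF sequentially_bot] by blast
  with X(3)[of k] show False by simp
qed

text \<open>The kernel has the same total mass C for every e. The difference \<phi>(x) - \<phi>(0)
  is bounded by \<eta> + A r, and r times the kernel is at most e (r^2 + e)^(-d/2 - 1/2), whose mass
  is a multiple of sqrt e. This avoids splitting the integral into a near and a far region.\<close>

lemma kernel_approximate_identity:
  assumes \<phi>: "test_fun d \<phi>" and d: "d \<ge> 1" and e: "\<And>k. e k > 0" "e \<longlonglongrightarrow> 0"
  shows "(\<lambda>k. \<integral>x. of_real (e k * (rsq d x + e k) powr (- (real d / 2 + 1))) * \<phi> x \<partial>Rmeas d)
    \<longlonglongrightarrow> of_real (pi powr (real d / 2) / Gamma (real d / 2 + 1)) * \<phi> (origin d)"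
proof (rule LIMSEQ_I)
  fix r :: real assume r: "r > 0"
  define C where "C = pi powr (real d / 2) / Gamma (real d / 2 + 1)"
  define C' where "C' = pi powr (real d / 2) * Gamma (1 / 2) / Gamma (real d / 2 + 1 / 2)"
  define Ke where "Ke k x = e k * (rsq d x + e k) powr (- (real d / 2 + 1))" for k x
  define Le where "Le k x = e k * (rsq d x + e k) powr (- (real d / 2 + 1 / 2))" for k x
  have C: "C > 0" unfolding C_def by (intro divide_pos_pos Gamma_real_pos) (auto simp: add_nonneg_pos)
  have Ke0: "Ke k x \<ge> 0" for k x using e(1)[of k] by (simp add: Ke_def)
  have hK: "has_bochner_integral (Rmeas d) (Ke k) C" for k
    using has_bochner_integral_mult_right[OF has_bochner_integral_kernel[of d "real d / 2 + 1" "e k"], of "e k"]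
      e(1)[of k] by (simp add: Ke_def[abs_def] C_def powr_minus field_simps)
  have hL: "has_bochner_integral (Rmeas d) (Le k) (C' * sqrt (e k))" for k
  proof -
    have "e k * (e k powr (- (1 / 2))) = sqrt (e k)"
      using e(1)[of k] powr_mult_base[of "e k" "- (1 / 2)"] by (simp add: powr_half_sqrt)
    then have "e k * (pi powr (real d / 2) * Gamma (1 / 2) / Gamma (real d / 2 + 1 / 2) * e k powr (- (1 / 2)))
        = C' * sqrt (e k)"
      unfolding C'_def by (simp add: mult_ac)
    then show ?thesis
      using has_bochner_integral_mult_right[OF has_bochner_integral_kernel[of d "real d / 2 + 1 / 2" "e k"], of "e k"]
        e(1)[of k] unfolding Le_def[abs_def] by simp
  qed
  define \<eta> where "\<eta> = r / (2 * C)"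
  have \<eta>: "\<eta> > 0" "\<eta> * C = r / 2" using r C by (simp_all add: \<eta>_def)
  have c\<phi>: "continuous_on (Rspace d) \<phi>" using test_fun_continuous[OF \<phi>, of "[]"] by simp
  obtain \<delta> where \<delta>: "\<delta> > 0" "\<And>x. x \<in> Rspace d \<Longrightarrow> rsq d x < \<delta> \<Longrightarrow> norm (\<phi> x - \<phi> (origin d)) < \<eta>"
    using continuous_near_origin[OF c\<phi> \<eta>(1)] by blast
  obtain B R where B: "B \<ge> 0" "\<And>x. x \<in> Rspace d \<Longrightarrow> norm (\<phi> x) \<le> (if rsq d x \<le> R\<^sup>2 then B else 0)"
    using test_fun_bounded_support[OF \<phi>] by metis
  have B': "norm (\<phi> x) \<le> B" if "x \<in> Rspace d" for x using B(1) B(2)[OF that] by (auto split: if_splits)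
  \<comment> \<open>Chosen so that A sqrt \<delta> = 2 B: where r^2 \<ge> \<delta>, the linear term
    A r alone dominates the trivial bound 2 B.\<close>
  define A where "A = 2 * B / sqrt \<delta>"
  have A: "A \<ge> 0" using B \<delta> by (simp add: A_def)
  have mod: "norm (\<phi> x - \<phi> (origin d)) \<le> \<eta> + A * sqrt (rsq d x)" if x: "x \<in> Rspace d" for x
  proof (cases "rsq d x < \<delta>")
    case True
    have "0 \<le> A * sqrt (rsq d x)" using A by simp
    then show ?thesis using \<delta>(2)[OF x True] by linarith
  next
    case False
    have "norm (\<phi> x - \<phi> (origin d)) \<le> 2 * B"
      using norm_triangle_ineq4[of "\<phi> x" "\<phi> (origin d)"] B'[OF x] B'[OF origin_in_Rspace] by linarith
    also have "2 * B = A * sqrt \<delta>" using \<delta> by (simp add: A_def)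
    also have "\<dots> \<le> A * sqrt (rsq d x)" using False A by (intro mult_left_mono) auto
    finally show ?thesis using \<eta> by simp
  qed
  have [measurable]: "\<phi> \<in> borel_measurable (Rmeas d)" using test_fun_measurable[OF \<phi>] .
  have [measurable]: "Ke k \<in> borel_measurable (Rmeas d)" for k unfolding Ke_def[abs_def] by measurable
  have bound: "norm ((\<integral>x. of_real (Ke k x) * \<phi> x \<partial>Rmeas d) - of_real C * \<phi> (origin d))
      \<le> r / 2 + A * C' * sqrt (e k)" for k
  proof -
    have i1: "integrable (Rmeas d) (\<lambda>x. of_real (Ke k x) * \<phi> x)"
    proof (rule Bochner_Integration.integrable_bound)
      show "integrable (Rmeas d) (\<lambda>x. B * Ke k x)"
        using hK[of k] by (auto simp: has_bochner_integral_iff)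
      show "AE x in Rmeas d. norm (of_real (Ke k x) * \<phi> x) \<le> norm (B * Ke k x)"
        using B' Ke0[of k] B(1)
        by (intro AE_I2) (auto simp: norm_mult abs_mult mult.commute[of B] intro!: mult_left_mono)
    qed measurable
    have i2: "integrable (Rmeas d) (\<lambda>x. complex_of_real (Ke k x))"
      using hK[of k] by (auto simp: has_bochner_integral_iff)
    have "of_real C = (\<integral>x. complex_of_real (Ke k x) \<partial>Rmeas d)"
      using hK[of k] by (simp add: has_bochner_integral_iff)
    then have "(\<integral>x. of_real (Ke k x) * \<phi> x \<partial>Rmeas d) - of_real C * \<phi> (origin d)
      = (\<integral>x. of_real (Ke k x) * (\<phi> x - \<phi> (origin d)) \<partial>Rmeas d)"
      using i1 i2 by (simp add: right_diff_distrib)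
    also have "norm (\<integral>x. of_real (Ke k x) * (\<phi> x - \<phi> (origin d)) \<partial>Rmeas d)
      \<le> (\<integral>x. \<eta> * Ke k x + A * Le k x \<partial>Rmeas d)"
    proof (rule order_trans[OF integral_norm_bound integral_mono])
      show "integrable (Rmeas d) (\<lambda>x. norm (of_real (Ke k x) * (\<phi> x - \<phi> (origin d))))"
        using i1 i2 by (intro integrable_norm) (simp add: right_diff_distrib)
      show "integrable (Rmeas d) (\<lambda>x. \<eta> * Ke k x + A * Le k x)"
        using hK[of k] hL[of k] by (auto simp: has_bochner_integral_iff)
      fix x assume "x \<in> space (Rmeas d)"
      then have x: "x \<in> Rspace d" by simp
      have pos: "rsq d x + e k > 0" using e(1)[of k] by (simp add: add_nonneg_pos)
      have "Ke k x * sqrt (rsq d x) \<le> Ke k x * sqrt (rsq d x + e k)"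
        using Ke0[of k x] e(1)[of k] by (intro mult_left_mono) auto
      also have "\<dots> = Le k x"
        using pos by (simp add: Ke_def Le_def powr_half_sqrt[symmetric] powr_add[symmetric] mult.assoc algebra_simps)
      finally have L: "A * (Ke k x * sqrt (rsq d x)) \<le> A * Le k x" using A by (rule mult_left_mono)
      have "norm (of_real (Ke k x) * (\<phi> x - \<phi> (origin d))) = Ke k x * norm (\<phi> x - \<phi> (origin d))"
        using Ke0[of k x] by (simp add: norm_mult)
      also have "\<dots> \<le> Ke k x * (\<eta> + A * sqrt (rsq d x))"
        using Ke0 mod[OF x] by (intro mult_left_mono)
      also have "\<dots> \<le> \<eta> * Ke k x + A * Le k x"
        using L by (simp add: algebra_simps)
      finally show "norm (of_real (Ke k x) * (\<phi> x - \<phi> (origin d))) \<le> \<eta> * Ke k x + A * Le k x" .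
    qed
    also have "\<dots> = \<eta> * C + A * (C' * sqrt (e k))"
      using hK[of k] hL[of k] by (simp add: has_bochner_integral_iff)
    finally show ?thesis using \<eta> by simp
  qed
  have "(\<lambda>k. A * C' * sqrt (e k)) \<longlonglongrightarrow> A * C' * sqrt 0"
    by (intro tendsto_intros e)
  then have "\<forall>\<^sub>F k in sequentially. A * C' * sqrt (e k) < r / 2"
    by (rule order_tendstoD) (use r in simp)
  then obtain N where N: "\<And>k. k \<ge> N \<Longrightarrow> A * C' * sqrt (e k) < r / 2"
    by (auto simp: eventually_sequentially)
  have "norm ((\<integral>x. of_real (Ke k x) * \<phi> x \<partial>Rmeas d) - of_real C * \<phi> (origin d)) < r" if "k \<ge> N" for k
    using bound[of k] N[OF that] by linarith
  then show "\<exists>N. \<forall>k\<ge>N. norm ((\<integral>x. of_real (e k * (rsq d x + e k) powr (- (real d / 2 + 1))) * \<phi> x \<partial>Rmeas d)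
      - of_real (pi powr (real d / 2) / Gamma (real d / 2 + 1)) * \<phi> (origin d)) < r"
    unfolding Ke_def C_def by blast
qed

section \<open>The Laplacian of radial power-logarithm functions\<close>

text \<open>A negative pure power majorises the power times logarithm. It has the advantage of being
  decreasing, so that it survives the shift s + \<epsilon>, whereas \<open>plog t\<close> need not
  be monotone.\<close>

lemma plog_bound:
  fixes S :: real
  assumes b: "fst t > - real d / 2" and d: "d \<ge> 1" and S: "S > 0"
  obtains a B where "0 \<le> a" "2 * a < real d" "B \<ge> 0"
    "\<And>s. 0 < s \<Longrightarrow> s \<le> S \<Longrightarrow> \<bar>plog t s\<bar> \<le> B * s powr (- a)"
proof -
  obtain b p q where t: "t = (b, p, q)" by (cases t)
  \<comment> \<open>The midpoint between max(0, -b) and d/2. It stays below d/2, and the gain b + a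
    > 0 absorbs the logarithm.\<close>
  define a where "a = (max 0 (- b) + real d / 2) / 2"
  have a: "0 \<le> a" "2 * a < real d" "b + a > 0"
    using b d by (auto simp: a_def t max_def field_simps)
  define \<epsilon> where "\<epsilon> = b + a"
  have \<epsilon>: "\<epsilon> > 0" using a by (simp add: \<epsilon>_def)
  define B where "B = S powr \<epsilon> * \<bar>p\<bar> + \<bar>q\<bar> * ((S powr (2 * \<epsilon>) + 1) / \<epsilon>)"
  have "\<bar>plog t s\<bar> \<le> B * s powr (- a)" if s: "0 < s" "s \<le> S" for s
  proof -
    have "\<epsilon> * \<bar>ln s\<bar> \<le> s powr \<epsilon> + s powr (- \<epsilon>)"
    proof (cases "ln s \<ge> 0")
      case True
      have "\<epsilon> * ln s \<le> s powr \<epsilon>"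
        using ln_le_minus_one[of "s powr \<epsilon>"] s by (simp add: ln_powr)
      moreover have "0 \<le> s powr (- \<epsilon>)" by simp
      ultimately show ?thesis using True by (simp only: abs_of_nonneg)
    next
      case False
      have "- \<epsilon> * ln s \<le> s powr (- \<epsilon>)"
        using ln_le_minus_one[of "s powr (- \<epsilon>)"] s by (simp add: ln_powr)
      moreover have "0 \<le> s powr \<epsilon>" by simp
      moreover have "\<bar>ln s\<bar> = - ln s" using False by simp
      ultimately show ?thesis by (simp only:)
    qed
    then have "s powr \<epsilon> * (\<epsilon> * \<bar>ln s\<bar>) \<le> s powr \<epsilon> * (s powr \<epsilon> + s powr (- \<epsilon>))"
      by (intro mult_left_mono) auto
    also have "\<dots> = s powr (2 * \<epsilon>) + 1"
      using s by (simp add: distrib_left powr_add[symmetric])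
    also have "\<dots> \<le> S powr (2 * \<epsilon>) + 1"
      using s \<epsilon> by (simp add: powr_mono2)
    finally have ln: "s powr \<epsilon> * \<bar>ln s\<bar> \<le> (S powr (2 * \<epsilon>) + 1) / \<epsilon>"
      using \<epsilon> by (simp add: field_simps)
    have eq: "\<bar>plog t s\<bar> = s powr (- a) * (s powr \<epsilon> * \<bar>p + q * ln s\<bar>)"
      using s by (simp add: t plog_def \<epsilon>_def abs_mult mult.assoc[symmetric] powr_add[symmetric])
    have "s powr \<epsilon> * \<bar>p + q * ln s\<bar> \<le> s powr \<epsilon> * \<bar>p\<bar> + \<bar>q\<bar> * (s powr \<epsilon> * \<bar>ln s\<bar>)"
      using mult_left_mono[OF abs_triangle_ineq[of p "q * ln s"], of "s powr \<epsilon>"]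
      by (simp add: abs_mult algebra_simps)
    also have "\<dots> \<le> B"
      unfolding B_def using s \<epsilon> ln by (intro add_mono mult_right_mono mult_left_mono powr_mono2) auto
    finally show ?thesis unfolding eq by (subst mult.commute[of B]) (rule mult_left_mono, auto)
  qed
  moreover have "B \<ge> 0" using \<epsilon> by (simp add: B_def)
  ultimately show ?thesis using that a by blast
qed

lemma plog_measurable [measurable]: "plog t \<in> borel_measurable borel"
  unfolding plog_def[abs_def] by (cases t) (simp, measurable)

lemma isCont_plog: "s > 0 \<Longrightarrow> isCont (plog t) s"
  using has_real_derivative_plog DERIV_isCont by blast

text \<open>Dominated convergence with one majorant for all k: a shifted argument only decreases
  s^(-a), and the support of \<phi> bounds the range of s.\<close>

lemma
  assumes \<phi>: "test_fun d \<phi>" and d: "d \<ge> 1" and t: "fst t > - real d / 2"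
    and e: "\<And>k. 0 < e k" "\<And>k. e k \<le> 1"
    and [measurable]: "\<And>k. h k \<in> borel_measurable borel" "h' \<in> borel_measurable borel"
    and bound: "\<And>k s. s > 0 \<Longrightarrow> \<bar>h k s\<bar> \<le> \<bar>plog t (s + e k)\<bar>"
    and lim: "\<And>s. s > 0 \<Longrightarrow> (\<lambda>k. h k s) \<longlonglongrightarrow> h' s"
  shows integrable_radial_limit: "integrable (Rmeas d) (\<lambda>x. of_real (h' (rsq d x)) * \<phi> x)"
    and integral_radial_limit:
      "(\<lambda>k. \<integral>x. of_real (h k (rsq d x)) * \<phi> x \<partial>Rmeas d) \<longlonglongrightarrow> (\<integral>x. of_real (h' (rsq d x)) * \<phi> x \<partial>Rmeas d)"
proof -
  obtain A R where A: "A \<ge> 0" "R \<ge> 0" "\<And>x. x \<in> Rspace d \<Longrightarrow> norm (\<phi> x) \<le> (if rsq d x \<le> R\<^sup>2 then A else 0)"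
    using test_fun_bounded_support[OF \<phi>] by metis
  \<comment> \<open>On the support the shifted argument is at most R^2 + 1, because e k \<le>
    1.\<close>
  have "R\<^sup>2 + 1 > 0" by (simp add: add_nonneg_pos)
  then obtain a B where a: "0 \<le> a" "2 * a < real d" "B \<ge> 0"
      "\<And>s. 0 < s \<Longrightarrow> s \<le> R\<^sup>2 + 1 \<Longrightarrow> \<bar>plog t s\<bar> \<le> B * s powr (- a)"
    using plog_bound[OF t d] by metis
  define w where "w x = (if rsq d x \<le> R\<^sup>2 then (A * B) * rsq d x powr (- a) else 0)" for x
  have [measurable]: "\<phi> \<in> borel_measurable (Rmeas d)" using test_fun_measurable[OF \<phi>] .
  have w: "integrable (Rmeas d) w"
  proof (rule integrable_dominated_bounded_support[where R = R and B = "A * B" and a = a])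
    show "w \<in> borel_measurable (Rmeas d)" unfolding w_def[abs_def] by measurable
  qed (use a A d in \<open>auto simp: w_def abs_mult\<close>)
  have dom: "AE x in Rmeas d. norm (of_real (h k (rsq d x)) * \<phi> x) \<le> w x" for k
    using AE_components_neq_0
  proof (rule AE_mp, intro AE_I2 impI)
    fix x assume x: "x \<in> space (Rmeas d)" "\<forall>i<d. x i \<noteq> 0"
    have pos: "rsq d x > 0" using rsq_pos[OF x(2) d] .
    show "norm (of_real (h k (rsq d x)) * \<phi> x) \<le> w x"
    proof (cases "rsq d x \<le> R\<^sup>2")
      case True
      have "\<bar>h k (rsq d x)\<bar> \<le> \<bar>plog t (rsq d x + e k)\<bar>" using bound[OF pos] .
      also have "\<dots> \<le> B * (rsq d x + e k) powr (- a)"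
        using True pos e[of k] by (intro a(4)) auto
      also have "\<dots> \<le> B * rsq d x powr (- a)"
        using pos e(1)[of k] a by (intro mult_left_mono powr_mono2') auto
      finally have "\<bar>h k (rsq d x)\<bar> * norm (\<phi> x) \<le> (B * rsq d x powr (- a)) * A"
        using A(3)[of x] True x a by (intro mult_mono) auto
      then show ?thesis using True by (simp add: w_def norm_mult mult_ac)
    qed (use A(3)[of x] x in \<open>auto simp: w_def\<close>)
  qed
  have conv: "AE x in Rmeas d. (\<lambda>k. of_real (h k (rsq d x)) * \<phi> x) \<longlonglongrightarrow> of_real (h' (rsq d x)) * \<phi> x"
    using AE_components_neq_0
    by (rule AE_mp, intro AE_I2 impI) (intro tendsto_intros lim rsq_pos d, auto)
  show "integrable (Rmeas d) (\<lambda>x. of_real (h' (rsq d x)) * \<phi> x)"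
    by (rule integrable_dominated_convergence[OF _ _ w conv dom]) measurable
  show "(\<lambda>k. \<integral>x. of_real (h k (rsq d x)) * \<phi> x \<partial>Rmeas d) \<longlonglongrightarrow> (\<integral>x. of_real (h' (rsq d x)) * \<phi> x \<partial>Rmeas d)"
    by (rule integral_dominated_convergence[OF _ _ w conv dom]) measurable
qed

lemma tendsto_plog_shift:
  assumes "s > 0" "e \<longlonglongrightarrow> 0"
  shows "(\<lambda>k. plog t (s + e k)) \<longlonglongrightarrow> plog t s"
proof (rule isCont_tendsto_compose[OF isCont_plog[OF assms(1)]])
  show "(\<lambda>k. s + e k) \<longlonglongrightarrow> s" using tendsto_add[OF tendsto_const assms(2), of s] by simp
qed

definition eps :: "nat \<Rightarrow> real" where "eps k = 1 / real (Suc k)"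

lemma eps: "eps k > 0" "eps k \<le> 1" "eps \<longlonglongrightarrow> 0"
  using LIMSEQ_inverse_real_of_nat by (simp_all add: eps_def[abs_def] inverse_eq_divide)

lemma integrable_plog:
  assumes "test_fun d \<phi>" "d \<ge> 1" "fst t > - real d / 2"
  shows "integrable (Rmeas d) (\<lambda>x. of_real (plog t (rsq d x)) * \<phi> x)"
  by (rule integrable_radial_limit[where e = eps and h = "\<lambda>k s. plog t (s + eps k)", OF assms])
     (auto intro: eps tendsto_plog_shift)

lemma integral_plog_limit:
  assumes "test_fun d \<phi>" "d \<ge> 1" "fst t > - real d / 2"
  shows "(\<lambda>k. \<integral>x. of_real (plog t (rsq d x + eps k)) * \<phi> x \<partial>Rmeas d)
    \<longlonglongrightarrow> (\<integral>x. of_real (plog t (rsq d x)) * \<phi> x \<partial>Rmeas d)"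
  by (rule integral_radial_limit[where e = eps and h = "\<lambda>k s. plog t (s + eps k)", OF assms])
     (auto intro: eps tendsto_plog_shift)

text \<open>The factor \<epsilon> \<le> s + \<epsilon> raises the exponent by one, so the product is
  dominated even when \<open>plog t\<close> itself is one order too singular, while pointwise it
  tends to 0.\<close>

lemma integral_eps_plog_limit:
  assumes \<phi>: "test_fun d \<phi>" and d: "d \<ge> 1" and t: "fst t > - real d / 2 - 1"
  shows "(\<lambda>k. \<integral>x. of_real (eps k * plog t (rsq d x + eps k)) * \<phi> x \<partial>Rmeas d) \<longlonglongrightarrow> 0"
proof -
  obtain b p q where tt: "t = (b, p, q)" by (cases t)
  have "(\<lambda>k. \<integral>x. of_real (eps k * plog t (rsq d x + eps k)) * \<phi> x \<partial>Rmeas d)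
    \<longlonglongrightarrow> (\<integral>x. of_real ((\<lambda>_. 0) (rsq d x)) * \<phi> x \<partial>Rmeas d)"
  proof (rule integral_radial_limit[where e = eps and h = "\<lambda>k s. eps k * plog t (s + eps k)" and t = "(b + 1, p, q)", OF \<phi> d])
    fix k and s :: real assume s: "s > 0"
    have "plog (b + 1, p, q) (s + eps k) = (s + eps k) * plog t (s + eps k)"
      using s eps(1)[of k] by (simp add: plog_def tt powr_add)
    then show "\<bar>eps k * plog t (s + eps k)\<bar> \<le> \<bar>plog (b + 1, p, q) (s + eps k)\<bar>"
      using s eps(1)[of k] by (simp add: abs_mult mult_right_mono)
  next
    fix s :: real assume "s > 0"
    then show "(\<lambda>k. eps k * plog t (s + eps k)) \<longlonglongrightarrow> 0"
      using tendsto_mult[OF eps(3) tendsto_plog_shift[OF _ eps(3), of s t]] by simp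
  qed (use t eps in \<open>auto simp: tt\<close>)
  then show ?thesis by simp
qed

text \<open>Green's identity gives 4 r^2 h'' with h'' evaluated at r^2 + \<epsilon>. Writing r^2 =
  (r^2 + \<epsilon>) - \<epsilon> recovers the radial Laplacian plus an error of order
  \<epsilon>.\<close>

lemma integral_plog_eps_blap:
  assumes \<phi>: "test_fun d \<phi>" and d: "d \<ge> 1"
  shows "(\<integral>x. of_real (plog t (rsq d x + eps k)) * blap d \<phi> x \<partial>Rmeas d)
    = (\<integral>x. of_real (plog (radlap d t) (rsq d x + eps k)) * \<phi> x
        - 4 * (of_real (eps k * plog (pl_deriv (pl_deriv t)) (rsq d x + eps k)) * \<phi> x) \<partial>Rmeas d)"
proof -
  let ?t1 = "pl_deriv t" and ?t2 = "pl_deriv (pl_deriv t)"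
  have der: "((\<lambda>s. plog u (s + eps k)) has_real_derivative plog (pl_deriv u) (s + eps k)) (at s)"
    if "s \<ge> 0" for s u
  proof -
    have "((\<lambda>s. plog u (s + eps k)) has_real_derivative plog (pl_deriv u) (s + eps k) * 1) (at s)"
      using that eps(1)[of k]
      by (intro DERIV_chain2[OF has_real_derivative_plog]) (auto intro!: derivative_eq_intros)
    then show ?thesis by simp
  qed
  have "(\<integral>x. of_real (plog t (rsq d x + eps k)) * blap d \<phi> x \<partial>Rmeas d)
    = (\<integral>x. of_real (4 * rsq d x * plog ?t2 (rsq d x + eps k)
        + 2 * real d * plog ?t1 (rsq d x + eps k)) * \<phi> x \<partial>Rmeas d)"
    using der by (intro integral_radial_blap[OF \<phi> d])
      (auto intro!: DERIV_continuous_on has_field_derivative_at_within[OF der])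
  also have "\<dots> = (\<integral>x. of_real (plog (radlap d t) (rsq d x + eps k)) * \<phi> x
        - 4 * (of_real (eps k * plog ?t2 (rsq d x + eps k)) * \<phi> x) \<partial>Rmeas d)"
  proof (intro Bochner_Integration.integral_cong refl)
    fix x
    have "4 * rsq d x * plog ?t2 (rsq d x + eps k) + 2 * real d * plog ?t1 (rsq d x + eps k)
      = plog (radlap d t) (rsq d x + eps k) - 4 * (eps k * plog ?t2 (rsq d x + eps k))"
      unfolding plog_radlap[OF add_nonneg_pos[OF rsq_nonneg eps(1)]] by (simp add: algebra_simps)
    then show "of_real (4 * rsq d x * plog ?t2 (rsq d x + eps k)
        + 2 * real d * plog ?t1 (rsq d x + eps k)) * \<phi> x
      = of_real (plog (radlap d t) (rsq d x + eps k)) * \<phi> x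
        - 4 * (of_real (eps k * plog ?t2 (rsq d x + eps k)) * \<phi> x)"
      by (simp add: left_diff_distrib)
  qed
  finally show ?thesis .
qed

lemma integrable_plog_eps:
  assumes \<phi>: "test_fun d \<phi>" and d: "d \<ge> 1"
  shows "integrable (Rmeas d) (\<lambda>x. of_real (plog t (rsq d x + eps k)) * \<phi> x)"
proof -
  obtain K where K: "\<And>x. x \<in> Rspace d \<Longrightarrow> rsq d x > K \<Longrightarrow> \<phi> x = 0"
    using test_fun_support[OF \<phi>] by blast
  have "isCont (\<lambda>s. plog t (s + eps k)) s" if "s \<ge> 0" for s
    using that eps(1)[of k] by (intro isCont_o2[OF _ isCont_plog]) (auto intro: continuous_intros)
  then have "continuous_on {0..} (\<lambda>s. plog t (s + eps k))"
    by (intro continuous_at_imp_continuous_on) auto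
  then have "continuous_on (Rspace d) (\<lambda>x. plog t (rsq d x + eps k))"
    by (rule continuous_on_compose2) (auto intro: continuous_on_rsq)
  then have "continuous_on (Rspace d) (\<lambda>x. complex_of_real (plog t (rsq d x + eps k)) * \<phi> x)"
    using test_fun_continuous[OF \<phi>, of "[]"] by (intro continuous_intros) auto
  then show ?thesis
    by (rule integrable_continuous_bounded_support[where K = K]) (use K d in auto)
qed

text \<open>The subcritical case. The bound on the exponent makes the radial Laplacian locally
  integrable and leaves h'' with an exponent above -d/2 - 1, so that the error term tends to
  0.\<close>

lemma integral_plog_blap:
  assumes \<phi>: "test_fun d \<phi>" and d: "d \<ge> 1" and t: "fst t > 1 - real d / 2"
  shows "(\<integral>x. of_real (plog t (rsq d x)) * blap d \<phi> x \<partial>Rmeas d)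
    = (\<integral>x. of_real (plog (radlap d t) (rsq d x)) * \<phi> x \<partial>Rmeas d)"
proof (rule LIMSEQ_unique)
  let ?t2 = "pl_deriv (pl_deriv t)"
  let ?I = "\<lambda>k. \<integral>x. of_real (plog t (rsq d x + eps k)) * blap d \<phi> x \<partial>Rmeas d"
  show "?I \<longlonglongrightarrow> (\<integral>x. of_real (plog t (rsq d x)) * blap d \<phi> x \<partial>Rmeas d)"
    using t by (intro integral_plog_limit test_fun_blap \<phi> d) auto
  have i2: "integrable (Rmeas d) (\<lambda>x. of_real (eps k * plog ?t2 (rsq d x + eps k)) * \<phi> x)" for k
    using integrable_mult_right[OF integrable_plog_eps[OF \<phi> d, of ?t2 k], of "of_real (eps k)"]
    by (simp add: mult.assoc)
  have "?I = (\<lambda>k. (\<integral>x. of_real (plog (radlap d t) (rsq d x + eps k)) * \<phi> x \<partial>Rmeas d)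
      - 4 * (\<integral>x. of_real (eps k * plog ?t2 (rsq d x + eps k)) * \<phi> x \<partial>Rmeas d))"
  proof
    fix k
    show "?I k = (\<integral>x. of_real (plog (radlap d t) (rsq d x + eps k)) * \<phi> x \<partial>Rmeas d)
      - 4 * (\<integral>x. of_real (eps k * plog ?t2 (rsq d x + eps k)) * \<phi> x \<partial>Rmeas d)"
      unfolding integral_plog_eps_blap[OF \<phi> d]
      using integrable_plog_eps[OF \<phi> d, of "radlap d t" k] i2[of k]
      by (subst Bochner_Integration.integral_diff) auto
  qed
  moreover have "\<dots> \<longlonglongrightarrow> (\<integral>x. of_real (plog (radlap d t) (rsq d x)) * \<phi> x \<partial>Rmeas d) - 4 * 0"
    using t by (intro tendsto_diff tendsto_mult_left integral_plog_limit integral_eps_plog_limit \<phi> d) auto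
  ultimately show "?I \<longlonglongrightarrow> (\<integral>x. of_real (plog (radlap d t) (rsq d x)) * \<phi> x \<partial>Rmeas d)" by simp
qed

text \<open>The critical case: the radial Laplacian vanishes identically and only the error term
  survives. Since h'' = -(d/2) \<rho> s^(-d/2 - 1), it is 2 d \<rho> times the approximate identity,
  and Gamma(d/2 + 1) = (d/2) Gamma(d/2) gives the constant.\<close>

lemma integral_plog_blap_fundamental:
  assumes \<phi>: "test_fun d \<phi>" and d: "d \<ge> 1" and t: "pl_deriv t = (- real d / 2, \<rho>, 0)"
  shows "(\<integral>x. of_real (plog t (rsq d x)) * blap d \<phi> x \<partial>Rmeas d)
    = of_real (4 * \<rho> * pi powr (real d / 2) / Gamma (real d / 2)) * \<phi> (origin d)"
proof (rule LIMSEQ_unique)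
  let ?t2 = "pl_deriv (pl_deriv t)"
  let ?I = "\<lambda>k. \<integral>x. of_real (plog t (rsq d x + eps k)) * blap d \<phi> x \<partial>Rmeas d"
  let ?K = "\<lambda>k x. of_real (eps k * (rsq d x + eps k) powr (- (real d / 2 + 1))) * \<phi> x"
  have "fst t = 1 - real d / 2" using arg_cong[OF t, of fst] by simp
  then show "?I \<longlonglongrightarrow> (\<integral>x. of_real (plog t (rsq d x)) * blap d \<phi> x \<partial>Rmeas d)"
    by (intro integral_plog_limit test_fun_blap \<phi> d) auto
  have pw: "- (real d / 2) - 1 = - 1 - real d / 2" by simp
  have I: "?I k = of_real (2 * real d * \<rho>) * (\<integral>x. ?K k x \<partial>Rmeas d)" for k
  proof -
    have "?I k = (\<integral>x. of_real (2 * real d * \<rho>) * ?K k x \<partial>Rmeas d)"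
      unfolding integral_plog_eps_blap[OF \<phi> d] radlap_eq_zero[OF t] t
      by (intro Bochner_Integration.integral_cong refl) (simp add: plog_def algebra_simps pw)
    then show ?thesis by simp
  qed
  have "?I \<longlonglongrightarrow> of_real (2 * real d * \<rho>) * (of_real (pi powr (real d / 2) / Gamma (real d / 2 + 1)) * \<phi> (origin d))"
    unfolding I by (intro tendsto_mult_left kernel_approximate_identity \<phi> d eps)
  also have "Gamma (real d / 2 + 1) = real d / 2 * Gamma (real d / 2)"
    using d by (intro Gamma_plus1) (auto elim!: nonpos_Ints_cases)
  also have "of_real (2 * real d * \<rho>) * (of_real (pi powr (real d / 2) / (real d / 2 * Gamma (real d / 2))) * \<phi> (origin d))
    = of_real (4 * \<rho> * pi powr (real d / 2) / Gamma (real d / 2)) * \<phi> (origin d)"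
    using d by (simp add: field_simps)
  finally show "?I \<longlonglongrightarrow> of_real (4 * \<rho> * pi powr (real d / 2) / Gamma (real d / 2)) * \<phi> (origin d)" .
qed

section \<open>A bump function\<close>

text \<open>Allowing a polynomial in 1/u in front of exp(-1/u) makes the family closed under
  differentiation: with y = 1/u the new polynomial is y^2 (p - p').\<close>

definition flat :: "real poly \<Rightarrow> real \<Rightarrow> real" where
  "flat p u = (if u > 0 then poly p (1 / u) * exp (- (1 / u)) else 0)"

definition flat_deriv :: "real poly \<Rightarrow> real poly" where
  "flat_deriv p = [:0, 0, 1:] * (p - pderiv p)"

lemma flat_uminus: "flat (- p) u = - flat p u"
  by (simp add: flat_def)

lemma poly_exp_tendsto_0: "((\<lambda>y. poly p y * exp (- y)) \<longlongrightarrow> (0 :: real)) at_top"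
proof -
  have "((\<lambda>y. \<Sum>i\<le>degree p. coeff p i * (y ^ i / exp y)) \<longlongrightarrow> (\<Sum>i\<le>degree p. coeff p i * 0)) at_top"
    by (intro tendsto_sum tendsto_mult_left tendsto_power_div_exp_0)
  then show ?thesis
    by (simp add: poly_altdef sum_distrib_right exp_minus sum_divide_distrib field_simps)
qed

lemma has_real_derivative_flat: "(flat p has_real_derivative flat (flat_deriv p) u) (at u)"
proof -
  consider "u > 0" | "u < 0" | "u = 0" by linarith
  then show ?thesis
  proof cases
    case 1
    have "((\<lambda>u. poly p (1 / u) * exp (- (1 / u))) has_real_derivative flat (flat_deriv p) u) (at u)"
      using 1
      by (auto intro!: derivative_eq_intros DERIV_chain2[OF poly_DERIV]
          simp: flat_def flat_deriv_def field_simps power2_eq_square)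
    moreover have "\<forall>\<^sub>F v in nhds u. poly p (1 / v) * exp (- (1 / v)) = flat p v"
      using eventually_nhds_in_open[of "{0<..}" u] 1
      by (auto elim!: eventually_mono simp: flat_def)
    ultimately show ?thesis by (subst (asm) DERIV_cong_ev) auto
  next
    case 2
    have "\<forall>\<^sub>F v in nhds u. 0 = flat p v"
      using eventually_nhds_in_open[of "{..<0}" u] 2
      by (auto elim!: eventually_mono simp: flat_def)
    then have "(flat p has_real_derivative 0) (at u)"
      using DERIV_cong_ev[of u u "\<lambda>_. 0" "flat p" 0 0] by simp
    then show ?thesis using 2 by (simp add: flat_def)
  next
    case 3
    have "((\<lambda>h. flat p h / h) \<longlongrightarrow> 0) (at_right 0)"
    proof -
      \<comment> \<open>The difference quotient at 0 becomes y p(y) exp(-y) under h = 1/y.\<close>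
      have "((\<lambda>y. poly ([:0, 1:] * p) y * exp (- y)) \<longlongrightarrow> 0) at_top"
        by (rule poly_exp_tendsto_0)
      moreover have "\<forall>\<^sub>F y in at_top. poly ([:0, 1:] * p) y * exp (- y) = flat p (inverse y) / inverse y"
        using eventually_gt_at_top[of 0] by eventually_elim (simp add: flat_def field_simps)
      ultimately have "((\<lambda>y. flat p (inverse y) / inverse y) \<longlongrightarrow> 0) at_top"
        by (rule Lim_transform_eventually)
      then show ?thesis by (subst filterlim_at_right_to_top)
    qed
    moreover have "((\<lambda>h. flat p h / h) \<longlongrightarrow> 0) (at_left 0)"
    proof (rule Lim_transform_eventually[OF tendsto_const])
      show "\<forall>\<^sub>F h in at_left 0. 0 = flat p h / h"
        by (auto simp: eventually_at_filter flat_def)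
    qed
    ultimately have "((\<lambda>h. flat p h / h) \<longlongrightarrow> 0) (at 0)"
      by (simp add: filterlim_split_at)
    then show ?thesis using 3 by (simp add: DERIV_def flat_def)
  qed
qed

text \<open>Sums of such products are closed under differentiation by the Leibniz rule, so
  smoothness and support in [-1, 1] hold for all iterated derivatives at once.\<close>

inductive_set bumps :: "(real \<Rightarrow> real) set" where
  product: "(\<lambda>t. flat p (1 + t) * flat q (1 - t)) \<in> bumps"
| add: "f \<in> bumps \<Longrightarrow> g \<in> bumps \<Longrightarrow> (\<lambda>t. f t + g t) \<in> bumps"

lemma bumps_deriv:
  assumes "f \<in> bumps"
  shows "deriv f \<in> bumps \<and> (\<forall>t. (f has_real_derivative deriv f t) (at t))"
proof -
  have "\<exists>g\<in>bumps. \<forall>t. (f has_real_derivative g t) (at t)"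
    using assms
  proof induction
    case (product p q)
    let ?g = "\<lambda>t. flat (flat_deriv p) (1 + t) * flat q (1 - t) + flat p (1 + t) * flat (- flat_deriv q) (1 - t)"
    have "((\<lambda>t. flat p (1 + t) * flat q (1 - t)) has_real_derivative ?g t) (at t)" for t
      by (auto intro!: derivative_eq_intros DERIV_chain2[OF has_real_derivative_flat] simp: flat_uminus)
    moreover have "?g \<in> bumps" by (intro bumps.intros)
    ultimately show ?case by (intro bexI[of _ ?g] allI)
  next
    case (add f g)
    then obtain f' g' where "f' \<in> bumps" "g' \<in> bumps"
      "\<And>t. (f has_real_derivative f' t) (at t)" "\<And>t. (g has_real_derivative g' t) (at t)" by blast
    then show ?case
      by (intro bexI[of _ "\<lambda>t. f' t + g' t"]) (auto intro: DERIV_add bumps.add)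
  qed
  then obtain g where g: "g \<in> bumps" "\<And>t. (f has_real_derivative g t) (at t)" by blast
  then have "deriv f = g" by (auto intro: DERIV_imp_deriv)
  with g show ?thesis by simp
qed

lemma bumps_funpow_deriv: "f \<in> bumps \<Longrightarrow> (deriv ^^ k) f \<in> bumps"
  by (induction k) (auto dest: bumps_deriv)

lemma bumps_continuous: "f \<in> bumps \<Longrightarrow> continuous_on S f"
  using bumps_deriv by (intro DERIV_continuous_on[of _ _ "deriv f"]) (auto intro: has_field_derivative_at_within)

lemma bumps_support: "f \<in> bumps \<Longrightarrow> \<bar>t\<bar> \<ge> 1 \<Longrightarrow> f t = 0"
  by (induction rule: bumps.induct) (auto simp: flat_def abs_if split: if_splits)

definition bump :: "real \<Rightarrow> real" where
  "bump t = flat 1 (1 + t) * flat 1 (1 - t)"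

lemma bump_in_bumps: "bump \<in> bumps"
  unfolding bump_def[abs_def] by (rule bumps.product)

text \<open>The function \<open>ks\<close> records the order of differentiation in each coordinate,
  so a partial derivative merely increments one entry.\<close>

definition bump_prod :: "nat \<Rightarrow> (nat \<Rightarrow> nat) \<Rightarrow> (nat \<Rightarrow> real) \<Rightarrow> complex" where
  "bump_prod d ks x = complex_of_real (\<Prod>i<d. (deriv ^^ ks i) bump (x i))"

lemma bump_prod_deriv:
  assumes i: "i < d"
  shows "((\<lambda>t. bump_prod d ks (x(i := x i + t))) has_vector_derivative
    bump_prod d (ks(i := Suc (ks i))) x) (at 0)"
proof -
  let ?c = "\<Prod>j\<in>{..<d} - {i}. (deriv ^^ ks j) bump (x j)"
  have eq: "bump_prod d ks (x(i := x i + t)) = ((deriv ^^ ks i) bump (x i + t)) *\<^sub>R of_real ?c" for t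
    unfolding bump_prod_def using i
    by (subst prod.remove[of _ i]) (auto simp: scaleR_conv_of_real intro!: prod.cong)
  have eq': "bump_prod d (ks(i := Suc (ks i))) x = ((deriv ^^ Suc (ks i)) bump (x i)) *\<^sub>R of_real ?c"
    unfolding bump_prod_def using i
    by (subst prod.remove[of _ i]) (auto simp: scaleR_conv_of_real intro!: prod.cong)
  have "((deriv ^^ ks i) bump has_real_derivative (deriv ^^ Suc (ks i)) bump (x i)) (at (x i))"
    using bumps_deriv[OF bumps_funpow_deriv[OF bump_in_bumps, of "ks i"]] by simp
  then have "((\<lambda>t. (deriv ^^ ks i) bump (x i + t)) has_real_derivative (deriv ^^ Suc (ks i)) bump (x i) * 1) (at 0)"
    by (intro DERIV_chain2[where g = "\<lambda>t. x i + t"]) (auto intro!: derivative_eq_intros)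
  from has_vector_derivative_scaleR[OF this has_vector_derivative_const, of "of_real ?c :: complex"]
  show ?thesis unfolding eq eq' by simp
qed

lemma ipd_bump_prod:
  assumes "set is \<subseteq> {..<d}"
  shows "ipd is (bump_prod d ks) = bump_prod d (\<lambda>i. count_list is i + ks i)"
  using assms
proof (induction "is")
  case (Cons i "is")
  have "ipd (i # is) (bump_prod d ks) x = bump_prod d (\<lambda>j. count_list (i # is) j + ks j) x" for x
  proof -
    have "ipd (i # is) (bump_prod d ks) x = pdiff i (bump_prod d (\<lambda>i. count_list is i + ks i)) x"
      using Cons by simp
    also have "\<dots> = bump_prod d ((\<lambda>j. count_list is j + ks j)(i := Suc (count_list is i + ks i))) x"
      using Cons.prems by (intro pdiff_eq bump_prod_deriv) auto
    also have "(\<lambda>j. count_list is j + ks j)(i := Suc (count_list is i + ks i))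
        = (\<lambda>j. count_list (i # is) j + ks j)"
      by auto
    finally show ?thesis .
  qed
  then show ?case by blast
qed auto

lemma test_fun_bump_prod: "test_fun d (bump_prod d ks)"
proof -
  have cont: "continuous_on (Rspace d) (bump_prod d js)" for js
    unfolding bump_prod_def
    by (intro continuous_on_of_real continuous_on_prod continuous_on_component subset_UNIV
        continuous_on_compose2[OF bumps_continuous[OF bumps_funpow_deriv[OF bump_in_bumps], of UNIV]])
  have "continuous_on (Rspace d) (ipd is (bump_prod d ks))" if "set is \<subseteq> {..<d}" for "is"
    unfolding ipd_bump_prod[OF that] by (rule cont)
  moreover have "((\<lambda>t. ipd is (bump_prod d ks) (x(i := x i + t))) has_vector_derivative
      ipd (i # is) (bump_prod d ks) x) (at 0)" if that: "set is \<subseteq> {..<d}" "i < d" for "is" i x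
  proof -
    have "ipd (i # is) (bump_prod d ks) x
        = bump_prod d ((\<lambda>i. count_list is i + ks i)(i := Suc (count_list is i + ks i))) x"
      unfolding ipd.simps ipd_bump_prod[OF that(1)] using that by (intro pdiff_eq bump_prod_deriv)
    then show ?thesis
      unfolding ipd_bump_prod[OF that(1)] using bump_prod_deriv[OF that(2)] by simp
  qed
  moreover have "bump_prod d ks x = 0" if "rsq d x > real d" for x
  proof -
    have "\<exists>i<d. \<bar>x i\<bar> \<ge> 1"
    proof (rule ccontr)
      assume "\<not> (\<exists>i<d. \<bar>x i\<bar> \<ge> 1)"
      then have "(x i)\<^sup>2 \<le> 1" if "i < d" for i using that by (metis abs_square_le_1 less_imp_le not_le)
      then have "rsq d x \<le> (\<Sum>i<d. 1)" unfolding rsq_def by (intro sum_mono) auto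
      with \<open>rsq d x > real d\<close> show False by simp
    qed
    then obtain i where i: "i < d" "\<bar>x i\<bar> \<ge> 1" by blast
    then have "(deriv ^^ ks i) bump (x i) = 0"
      by (intro bumps_support bumps_funpow_deriv bump_in_bumps)
    then show ?thesis
      unfolding bump_prod_def of_real_eq_0_iff using i by (intro prod_zero) auto
  qed
  ultimately show ?thesis unfolding test_fun_def by blast
qed

lemma exists_test_fun: "\<exists>\<phi>. test_fun d \<phi> \<and> \<phi> (origin d) \<noteq> 0"
proof (intro exI conjI)
  show "test_fun d (bump_prod d (\<lambda>_. 0))" by (rule test_fun_bump_prod)
  show "bump_prod d (\<lambda>_. 0) (origin d) \<noteq> 0"
    by (simp add: bump_prod_def origin_def bump_def flat_def)
qed

section \<open>Bosonic fundamental solutions and their normalising constants\<close>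

text \<open>As long as two or more Laplacians remain, the exponent exceeds 1 - d/2 and the
  subcritical step applies; the last Laplacian meets the critical exponent and yields the point
  value.\<close>

lemma integral_plog_funpow_blap:
  assumes \<phi>: "test_fun d \<phi>" and d: "d \<ge> 1"
    and "fst t = real (Suc j) - real d / 2"
    and "pl_deriv ((radlap (real d) ^^ j) t) = (- real d / 2, \<rho>, 0)"
  shows "(\<integral>x. of_real (plog t (rsq d x)) * (blap d ^^ Suc j) \<phi> x \<partial>Rmeas d)
    = of_real (4 * \<rho> * pi powr (real d / 2) / Gamma (real d / 2)) * \<phi> (origin d)"
  using assms(3,4)
proof (induction j arbitrary: t)
  case 0
  then show ?case using integral_plog_blap_fundamental[OF \<phi> d, of t \<rho>] by simp
next
  case (Suc j)
  have "(\<integral>x. of_real (plog t (rsq d x)) * (blap d ^^ Suc (Suc j)) \<phi> x \<partial>Rmeas d)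
    = (\<integral>x. of_real (plog (radlap (real d) t) (rsq d x)) * (blap d ^^ Suc j) \<phi> x \<partial>Rmeas d)"
    using integral_plog_blap[OF test_fun_funpow_blap[OF \<phi>] d, of t "Suc j"] Suc.prems(1) by simp
  also have "\<dots> = of_real (4 * \<rho> * pi powr (real d / 2) / Gamma (real d / 2)) * \<phi> (origin d)"
    using Suc.prems by (intro Suc.IH) (simp_all add: funpow_swap1)
  finally show ?case .
qed

lemma pl_deriv_funpow_radlap_nu_coeffs:
  assumes "odd D \<or> D > 0"
  shows "pl_deriv ((radlap (of_int D) ^^ p) (nu_coeffs (Suc p) D))
    = (- of_int D / 2, (-1) ^ Suc p * Gamma (of_int D / 2) / (4 * pi powr (of_int D / 2)), 0)"
proof (cases "odd D \<or> 2 * int (Suc p) < D")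
  case True
  then show ?thesis
    using pl_deriv_funpow_radlap_fundamental[OF assms, of p "1 / gamma_expl p D" 0]
    unfolding nu_coeffs_def by simp
next
  case False
  then show ?thesis
    using pl_deriv_funpow_radlap_fundamental[OF assms, of p 0 "- 1 / (2 * gamma_expl p D)"]
    unfolding nu_coeffs_def by simp
qed

lemma bfs_nu_coeffs:
  assumes d: "d \<ge> 1"
  shows "bfs d (Suc p) (plog (nu_coeffs (Suc p) (int d)))"
  unfolding bfs_def
proof (intro allI impI conjI)
  fix \<phi> assume \<phi>: "test_fun d \<phi>"
  define t where "t = nu_coeffs (Suc p) (int d)"
  have fst: "fst t = real (Suc p) - real d / 2" by (simp add: t_def nu_coeffs_def)
  show "integrable (Rmeas d) (\<lambda>x. complex_of_real (plog (nu_coeffs (Suc p) (int d)) (rsq d x)) * (blap d ^^ Suc p) \<phi> x)"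
    using fst by (intro integrable_plog test_fun_funpow_blap \<phi> d) (simp add: t_def)
  define \<rho> where "\<rho> = (-1) ^ Suc p * Gamma (real d / 2) / (4 * pi powr (real d / 2))"
  have "pl_deriv ((radlap (real d) ^^ p) t) = (- real d / 2, \<rho>, 0)"
    using pl_deriv_funpow_radlap_nu_coeffs[of "int d" p] d by (simp add: t_def \<rho>_def)
  from integral_plog_funpow_blap[OF \<phi> d fst this]
  have "(\<integral>x. complex_of_real (plog t (rsq d x)) * (blap d ^^ Suc p) \<phi> x \<partial>Rmeas d)
    = of_real (4 * \<rho> * pi powr (real d / 2) / Gamma (real d / 2)) * \<phi> (origin d)" .
  moreover have "Gamma (real d / 2) > 0" using d by (intro Gamma_real_pos) simp
  then have "4 * \<rho> * pi powr (real d / 2) / Gamma (real d / 2) = (-1) ^ Suc p"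
    by (simp add: \<rho>_def)
  ultimately show "(\<integral>x. complex_of_real (plog (nu_coeffs (Suc p) (int d)) (rsq d x)) * (blap d ^^ Suc p) \<phi> x \<partial>Rmeas d)
    = (-1) ^ Suc p * \<phi> (origin d)"
    by (simp add: t_def)
qed

lemma gamma_expl_neq_0:
  assumes "even D"
  shows "gamma_expl p D \<noteq> 0"
proof (cases "2 * int (Suc p) < D")
  case True
  then have "real_of_int (2 * int (Suc p)) < of_int D" by (simp only: of_int_less_iff)
  then have "real_of_int D / 2 - real p - 1 > 0" by simp
  then have "Gamma (real_of_int D / 2 - real p - 1) > 0" by (rule Gamma_real_pos)
  then have "Gamma (real_of_int D / 2 - real p - 1) \<noteq> 0" by (rule less_imp_neq[symmetric])
  then have "gamma_c p D \<noteq> 0" unfolding gamma_c_def by simp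
  then show ?thesis using True by (simp add: gamma_expl_def)
qed (use assms in \<open>simp add: gamma_expl_def\<close>)

text \<open>The candidate F c is F 1 divided by c, so its pairing with a fixed test function is I /
  c. The explicit constant satisfies the description, and I \<noteq> 0 then forces every other
  candidate to equal it.\<close>

lemma gamma'_c_eq:
  assumes d: "even d" "d \<ge> 1"
  shows "gamma'_c p d = gamma_expl p (int d)"
proof -
  define e where "e = (2 * real (Suc p) - real d) / 2"
  define F where "F c = (\<lambda>s. if 2 * Suc p < d then s powr e / c else - (s powr e * (ln s / 2)) / c)"
    for c :: real
  define g where "g = gamma_expl p (int d)"
  have g0: "g \<noteq> 0" using gamma_expl_neq_0 d by (simp add: g_def)
  have "e = real (Suc p) - real d / 2" by (simp add: e_def field_simps)
  then have "F g = plog (nu_coeffs (Suc p) (int d))"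
    using d by (auto simp: fun_eq_iff F_def nu_coeffs_def plog_def g_def)
  then have g: "bfs d (Suc p) (F g)" using bfs_nu_coeffs[OF d(2)] by simp
  have "gamma'_c p d = (THE c. c \<noteq> 0 \<and> bfs d (Suc p) (F c))"
    by (simp only: gamma'_c_def F_def e_def)
  also have "\<dots> = g"
  proof (rule the_equality)
    show "g \<noteq> 0 \<and> bfs d (Suc p) (F g)" using g0 g by blast
    fix c assume c: "c \<noteq> 0 \<and> bfs d (Suc p) (F c)"
    obtain \<phi> where \<phi>: "test_fun d \<phi>" "\<phi> (origin d) \<noteq> 0" using exists_test_fun by blast
    define I where "I = (\<integral>x. complex_of_real (F 1 (rsq d x)) * (blap d ^^ Suc p) \<phi> x \<partial>Rmeas d)"
    have I: "I / of_real c = (-1) ^ Suc p * \<phi> (origin d)" if "bfs d (Suc p) (F c)" "c \<noteq> 0" for c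
    proof -
      have "(\<integral>x. complex_of_real (F c (rsq d x)) * (blap d ^^ Suc p) \<phi> x \<partial>Rmeas d)
        = (\<integral>x. (complex_of_real (F 1 (rsq d x)) * (blap d ^^ Suc p) \<phi> x) / of_real c \<partial>Rmeas d)"
        by (intro Bochner_Integration.integral_cong refl) (simp add: F_def)
      also have "\<dots> = I / of_real c" unfolding I_def by (rule integral_divide_zero)
      finally show ?thesis using that \<phi> unfolding bfs_def by simp
    qed
    have "I / of_real c = I / of_real g" using I[of c] I[of g] c g g0 by simp
    moreover have "I \<noteq> 0" using I[of g] g g0 \<phi> by auto
    ultimately show "c = g" using c g0 by (simp add: field_simps)
  qed
  finally show ?thesis by (simp add: g_def)
qed

lemma nu_eq:
  assumes "d \<ge> 1"
  shows "nu d (Suc p) = plog (nu_coeffs (Suc p) (int d))"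
proof
  fix s
  have e: "(2 * real (Suc p) - real d) / 2 = real (Suc p) - real d / 2" by (simp add: field_simps)
  show "nu d (Suc p) s = plog (nu_coeffs (Suc p) (int d)) s"
  proof (cases "odd d")
    case True
    then show ?thesis unfolding nu_def e by (simp add: nu_coeffs_def plog_def gamma_expl_def)
  next
    case False
    then show ?thesis
      using gamma'_c_eq[of d p] assms unfolding nu_def e by (auto simp: nu_coeffs_def plog_def)
  qed
qed

lemma nu_equiv_eq:
  assumes "odd (int m - 2 * int n) \<or> int m - 2 * int n > 0"
  shows "nu_equiv m n (Suc p) = plog (nu_coeffs (Suc p) (int m - 2 * int n))"
proof
  fix s
  define M where "M = int m - 2 * int n"
  have e: "(2 * real (Suc p) - of_int M) / 2 = real (Suc p) - of_int M / 2" by (simp add: field_simps)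
  show "nu_equiv m n (Suc p) s = plog (nu_coeffs (Suc p) M) s"
  proof (cases "odd M")
    case True
    then show ?thesis
      unfolding nu_equiv_def M_def[symmetric] Let_def e
      by (simp add: nu_coeffs_def plog_def gamma_expl_def)
  next
    case False
    then have "gamma'_c p (nat M) = gamma_expl p M"
      using gamma'_c_eq[of "nat M" p] assms by (simp add: M_def[symmetric] even_nat_iff)
    with False show ?thesis
      unfolding nu_equiv_def M_def[symmetric] Let_def e by (auto simp: nu_coeffs_def plog_def)
  qed
qed

text \<open>Lowering m by 2n and l + n by n preserves parity, the comparison 2l < M, the exponent l
  - M/2 and the argument of Gamma (or the index of its residue). What changes in the constant is
  2^(2n), a quotient of factorials and pi^n.\<close>

lemma nu_coeffs_dimension_shift:
  fixes m n l :: nat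
  defines "M \<equiv> int m - 2 * int n"
  assumes l: "l \<ge> 1"
  shows "pl_scale (pi ^ n * 2 ^ (2 * n) * fact (n + l - 1) / fact (l - 1)) (nu_coeffs (l + n) (int m))
    = nu_coeffs l M"
proof -
  define C :: real where "C = pi ^ n * 2 ^ (2 * n) * fact (n + l - 1) / fact (l - 1)"
  have C0: "C \<noteq> 0" by (simp add: C_def)
  obtain p where p: "l = Suc p" using l by (cases l) auto
  have cond: "odd (int m) \<or> 2 * int (l + n) < int m \<longleftrightarrow> odd M \<or> 2 * int l < M"
    by (auto simp: M_def)
  have M2: "real_of_int M / 2 = real m / 2 - real n" by (simp add: M_def field_simps)
  have pim: "pi powr (real m / 2) = pi ^ n * pi powr (of_int M / 2)"
    by (simp add: M2 powr_diff powr_realpow)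
  have "gamma_expl (l + n - 1) (int m) = C * gamma_expl (l - 1) M"
  proof (cases "odd M \<or> 2 * int l < M")
    case True
    have \<Gamma>: "real m / 2 - real (p + n) - 1 = of_int M / 2 - real p - 1" by (simp add: M2)
    have "gamma_c (p + n) (int m) = C * gamma_c p M"
      unfolding gamma_c_def of_int_of_nat_eq \<Gamma> pim
      by (simp add: C_def p power_add power_mult add.commute)
    then show ?thesis using True cond by (simp add: gamma_expl_def p)
  next
    case False
    have q: "nat (int (Suc (p + n)) - int m div 2) = nat (int (Suc p) - M div 2)"
      by (simp add: M_def)
    have "\<not> (odd (int m) \<or> 2 * int (Suc (p + n)) < int m)" "\<not> (odd M \<or> 2 * int (Suc p) < M)"
      using False cond by (simp_all add: p)
    then show ?thesis
      unfolding gamma_expl_def using q pim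
      by (simp only: p if_False) (simp add: C_def p power_add power_mult add.commute)
  qed
  then have g: "1 / gamma_expl (l + n - 1) (int m) * C = 1 / gamma_expl (l - 1) M"
    using C0 by simp
  show ?thesis
    unfolding C_def[symmetric] nu_coeffs_def cond using g C0
    by (auto simp: M2 mult.commute)
qed

section \<open>Radial superfunctions\<close>

definition splog :: "nat \<Rightarrow> real \<times> real \<times> real \<Rightarrow> real \<Rightarrow> nat set \<Rightarrow> complex" where
  "splog n t s A = (\<Sum>j\<le>n. of_real ((-1) ^ j / fact j * plog ((pl_deriv ^^ j) t) s) * pair_power n j A)"

text \<open>The pairing of \<open>splog\<close> with \<phi>, with the Grassmann coefficients pulled
  out of the integrals: fermionic derivatives act on \<open>pair_power\<close> only, bosonic ones on
  the integrals only.\<close>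

definition splog_dist :: "nat \<Rightarrow> nat \<Rightarrow> real \<times> real \<times> real \<Rightarrow> gdist" where
  "splog_dist m n t A \<phi> = (\<Sum>j\<le>n. of_real ((-1) ^ j / fact j) * pair_power n j A
     * (\<integral>x. of_real (plog ((pl_deriv ^^ j) t) (rsq m x)) * \<phi> x \<partial>Rmeas m))"

lemma funpow_deriv_plog:
  "s > 0 \<Longrightarrow> (deriv ^^ j) (plog t) s = plog ((pl_deriv ^^ j) t) s"
proof (induction j arbitrary: s)
  case (Suc j)
  have "\<forall>\<^sub>F u in nhds s. (deriv ^^ j) (plog t) u = plog ((pl_deriv ^^ j) t) u"
    using eventually_nhds_in_open[of "{0<..}" s] Suc by (auto elim!: eventually_mono)
  then have "deriv ((deriv ^^ j) (plog t)) s = deriv (plog ((pl_deriv ^^ j) t)) s"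
    by (rule deriv_cong_ev) simp
  also have "\<dots> = plog ((pl_deriv ^^ Suc j) t) s"
    using has_real_derivative_plog[OF Suc.prems] by (simp add: DERIV_imp_deriv)
  finally show ?case by simp
qed simp

lemma sfunR2_plog: "rsq m x > 0 \<Longrightarrow> sfunR2 m n (plog t) x = splog n t (rsq m x)"
  by (simp add: sfunR2_def splog_def gpow_xgr2 funpow_deriv_plog fun_eq_iff)

lemma plog_scale: "plog (pl_scale k t) s = k * plog t s"
  by (cases t) (simp add: plog_def algebra_simps)

lemma funpow_pl_deriv_scale: "(pl_deriv ^^ j) (pl_scale k t) = pl_scale k ((pl_deriv ^^ j) t)"
  by (induction j) (simp_all add: pl_deriv_scale)

lemma splog_scale: "splog n (pl_scale k t) s A = of_real k * splog n t s A"
  by (simp add: splog_def funpow_pl_deriv_scale plog_scale sum_distrib_left mult_ac)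

lemma supernu_eq_splog:
  assumes "m \<ge> 1" "l \<ge> 1" "rsq m x > 0"
  shows "supernu m n l x = splog n (nu_coeffs l (int m - 2 * int n)) (rsq m x)"
proof -
  obtain p where "l + n = Suc p" using assms by (cases "l + n") auto
  then have "supernu m n l x A = splog n (pl_scale (pi ^ n * 2 ^ (2 * n) * fact (n + l - 1) / fact (l - 1))
      (nu_coeffs (l + n) (int m))) (rsq m x) A" for A
    unfolding supernu_def splog_scale using nu_eq[OF assms(1)] sfunR2_plog[OF assms(3)] by simp
  then show ?thesis
    unfolding nu_coeffs_dimension_shift[OF assms(2)] by blast
qed

text \<open>At r = 0 the iterated \<open>deriv\<close> has no useful value, but the superfunction
  depends on x through r^2 alone, so it is some constant there.\<close>

lemma supernu_measurable:
  assumes "m \<ge> 1" "l \<ge> 1"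
  shows "(\<lambda>x. supernu m n l x A) \<in> borel_measurable (Rmeas m)"
proof -
  define t where "t = nu_coeffs l (int m - 2 * int n)"
  define c where "c = of_real (pi ^ n * 2 ^ (2 * n) * fact (n + l - 1) / fact (l - 1)) *
    (\<Sum>j\<le>n. complex_of_real ((-1) ^ j / fact j * (deriv ^^ j) (nu m (l + n)) 0) * gpow (xgr2 n) j A)"
  have "supernu m n l x A = (if rsq m x > 0 then splog n t (rsq m x) A else c)" for x
  proof (cases "rsq m x > 0")
    case True
    then show ?thesis unfolding supernu_eq_splog[OF assms True] by (simp add: t_def)
  next
    case False
    then have "rsq m x = 0" using rsq_nonneg[of m x] by linarith
    then show ?thesis by (simp add: supernu_def sfunR2_def c_def)
  qed
  moreover have "(\<lambda>x. if rsq m x > 0 then splog n t (rsq m x) A else c) \<in> borel_measurable (Rmeas m)"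
    unfolding splog_def by measurable
  ultimately show ?thesis by simp
qed

lemma splog_integral:
  assumes \<phi>: "test_fun m \<phi>" and m: "m \<ge> 1" and t: "fst t - real n > - real m / 2"
  shows "has_bochner_integral (Rmeas m) (\<lambda>x. splog n t (rsq m x) A * \<phi> x) (splog_dist m n t A \<phi>)"
proof -
  have "has_bochner_integral (Rmeas m) (\<lambda>x. \<Sum>j\<le>n. of_real ((-1) ^ j / fact j) * pair_power n j A
      * (of_real (plog ((pl_deriv ^^ j) t) (rsq m x)) * \<phi> x)) (splog_dist m n t A \<phi>)"
    unfolding splog_dist_def
  proof (intro has_bochner_integral_sum has_bochner_integral_mult_right has_bochner_integral_integrable
      integrable_plog \<phi> m)
    fix j assume "j \<in> {..n}"
    then have "real j \<le> real n" by simp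
    with t show "fst ((pl_deriv ^^ j) t) > - real m / 2" by simp
  qed
  moreover have "splog n t (rsq m x) A * \<phi> x = (\<Sum>j\<le>n. of_real ((-1) ^ j / fact j) * pair_power n j A
      * (of_real (plog ((pl_deriv ^^ j) t) (rsq m x)) * \<phi> x))" for x
    unfolding splog_def sum_distrib_right by (intro sum.cong refl) (simp add: mult_ac)
  ultimately show ?thesis by (simp only:)
qed

text \<open>The most singular coefficient is the n-th derivative, with exponent l - M/2 - n = l -
  m/2 in r^2. It is locally integrable because l > 0.\<close>

lemma supernu_integral:
  assumes \<phi>: "test_fun m \<phi>" and m: "m \<ge> 1" and l: "l \<ge> 1"
  shows "has_bochner_integral (Rmeas m) (\<lambda>x. supernu m n l x A * \<phi> x)
    (splog_dist m n (nu_coeffs l (int m - 2 * int n)) A \<phi>)"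
proof -
  let ?t = "nu_coeffs l (int m - 2 * int n)"
  have "fst ?t - real n = real l - real m / 2" by (simp add: nu_coeffs_def field_simps)
  then have "fst ?t - real n > - real m / 2" using l by simp
  note int = splog_integral[OF \<phi> m this, of A]
  have [measurable]: "\<phi> \<in> borel_measurable (Rmeas m)" using test_fun_measurable[OF \<phi>] .
  note [measurable] = supernu_measurable[OF m l]
  have "AE x in Rmeas m. supernu m n l x A * \<phi> x = splog n ?t (rsq m x) A * \<phi> x"
    using AE_components_neq_0
    by (rule AE_mp) (use supernu_eq_splog[OF m l] rsq_pos[OF _ m] in \<open>auto intro!: AE_I2\<close>)
  then show ?thesis
    using int by (subst has_bochner_integral_cong_AE[of _ _ "\<lambda>x. splog n ?t (rsq m x) A * \<phi> x"])
      (auto dest: borel_measurable_has_bochner_integral)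
qed

text \<open>The derivatives turn the term of index j + 1 into one of index j. The factor -(j + 1)(n
  - j) meets (-1)^(j + 1) / (j + 1)!, leaving (n - j) (-1)^j / j!. The old term of index 0 vanishes,
  and the new term of index n may be included since n - j = 0 there.\<close>

lemma sum_fder_splog_dist:
  "(\<Sum>i\<in>{1..n}. fder (2 * i - 1) (fder (2 * i) (\<lambda>B. splog_dist m n t B \<phi>)) A)
    = (\<Sum>j\<le>n. of_real ((-1) ^ j / fact j) * pair_power n j A * (of_nat (n - j)
        * (\<integral>x. of_real (plog ((pl_deriv ^^ Suc j) t) (rsq m x)) * \<phi> x \<partial>Rmeas m)))"
proof -
  define I where "I j = (\<integral>x. of_real (plog ((pl_deriv ^^ j) t) (rsq m x)) * \<phi> x \<partial>Rmeas m)" for j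
  define c where "c j = of_real ((-1) ^ j / fact j) * I j" for j
  have sd: "splog_dist m n t B \<phi> = (\<Sum>j\<le>n. c j * pair_power n j B)" for B
    by (simp add: splog_dist_def c_def I_def mult_ac)
  have lin: "fder a (fder b (\<lambda>B. \<Sum>j\<le>n. c j * pair_power n j B)) A
      = (\<Sum>j\<le>n. c j * fder a (fder b (pair_power n j)) A)" for a b
    by (simp add: fder_def sum_negf)
  have "(\<Sum>i\<in>{1..n}. fder (2 * i - 1) (fder (2 * i) (\<lambda>B. splog_dist m n t B \<phi>)) A)
    = (\<Sum>j\<le>n. c j * (\<Sum>i\<in>{1..n}. fder (2 * i - 1) (fder (2 * i) (pair_power n j)) A))"
    unfolding sd lin sum_distrib_left by (rule sum.swap)
  also have "\<dots> = (\<Sum>j\<le>n. c j * (- of_nat (j * (n + 1 - j)) * pair_power n (j - 1) A))"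
    by (simp only: sum_fder_pair_power)
  also have "\<dots> = (\<Sum>j<n. c (Suc j) * (- of_nat (Suc j * (n - j)) * pair_power n j A))"
    by (simp add: lessThan_Suc_atMost[symmetric] sum.lessThan_Suc_shift del: sum.lessThan_Suc of_nat_Suc of_nat_mult mult_Suc mult_Suc_right)
  also have "\<dots> = (\<Sum>j<n. of_real ((-1) ^ j / fact j) * pair_power n j A * (of_nat (n - j) * I (Suc j)))"
  proof (intro sum.cong refl)
    fix j
    have "((-1) ^ Suc j / fact (Suc j)) * - real (Suc j) = (-1) ^ j / fact j"
      by (subst fact_Suc) (simp del: of_nat_Suc fact_Suc)
    then have "complex_of_real ((-1) ^ Suc j / fact (Suc j)) * - of_nat (Suc j) = of_real ((-1) ^ j / fact j)"
      by (metis of_real_minus of_real_mult of_real_of_nat_eq)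
    then have "of_real ((-1) ^ j / fact j) * pair_power n j A * (of_nat (n - j) * I (Suc j))
      = (complex_of_real ((-1) ^ Suc j / fact (Suc j)) * - of_nat (Suc j)) * pair_power n j A * (of_nat (n - j) * I (Suc j))"
      by simp
    also have "\<dots> = c (Suc j) * (- of_nat (Suc j * (n - j)) * pair_power n j A)"
      unfolding c_def of_nat_mult by (simp only: mult_ac minus_mult_left[symmetric] minus_mult_right[symmetric])
    finally show "c (Suc j) * (- of_nat (Suc j * (n - j)) * pair_power n j A)
      = of_real ((-1) ^ j / fact j) * pair_power n j A * (of_nat (n - j) * I (Suc j))" ..
  qed
  also have "\<dots> = (\<Sum>j\<le>n. of_real ((-1) ^ j / fact j) * pair_power n j A * (of_nat (n - j) * I (Suc j)))"
    by (simp add: lessThan_Suc_atMost[symmetric])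
  finally show ?thesis by (simp add: I_def)
qed

text \<open>A \<open>gdist\<close> accepts arbitrary functions, so agreement with
  \<open>splog_dist\<close> is asked for on test functions only. This suffices because
  \<open>blap\<close> preserves test functions.\<close>

lemma slap_splog_dist:
  assumes T: "\<And>A \<psi>. test_fun m \<psi> \<Longrightarrow> T A \<psi> = splog_dist m n t A \<psi>" and \<phi>: "test_fun m \<phi>"
  shows "slap m n T A \<phi> = (\<Sum>j\<le>n. of_real ((-1) ^ j / fact j) * pair_power n j A *
     ((\<integral>x. of_real (plog ((pl_deriv ^^ j) t) (rsq m x)) * blap m \<phi> x \<partial>Rmeas m)
      - 4 * of_nat (n - j) * (\<integral>x. of_real (plog ((pl_deriv ^^ Suc j) t) (rsq m x)) * \<phi> x \<partial>Rmeas m)))"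
proof -
  have "(\<lambda>B. T B \<phi>) = (\<lambda>B. splog_dist m n t B \<phi>)" using T[OF \<phi>] by blast
  then have "slap m n T A \<phi> = splog_dist m n t A (blap m \<phi>)
    - 4 * (\<Sum>i\<in>{1..n}. fder (2 * i - 1) (fder (2 * i) (\<lambda>B. splog_dist m n t B \<phi>)) A)"
    by (simp only: slap_def T[OF test_fun_blap[OF \<phi>]])
  then show ?thesis
    unfolding sum_fder_splog_dist unfolding splog_dist_def sum_distrib_left sum_subtractf[symmetric]
    by (simp only: right_diff_distrib mult_ac)
qed

text \<open>The j-th derivative sees dimension m bosonically and loses 2(n - j) to the fermionic
  term. That is M + 2j, the dimension at which the radial Laplacian commutes past j derivatives to
  become the one of dimension M on h.\<close>

lemma integral_plog_super:
  assumes \<phi>: "test_fun m \<phi>" and m: "m \<ge> 1" and j: "j \<le> n" and t: "fst t - real j > 1 - real m / 2"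
  shows "(\<integral>x. of_real (plog ((pl_deriv ^^ j) t) (rsq m x)) * blap m \<phi> x \<partial>Rmeas m)
      - 4 * of_nat (n - j) * (\<integral>x. of_real (plog ((pl_deriv ^^ Suc j) t) (rsq m x)) * \<phi> x \<partial>Rmeas m)
    = (\<integral>x. of_real (plog ((pl_deriv ^^ j) (radlap (real m - 2 * real n) t)) (rsq m x)) * \<phi> x \<partial>Rmeas m)"
proof -
  let ?u = "(pl_deriv ^^ j) t"
  have u: "fst ?u > 1 - real m / 2" using t by simp
  have i1: "integrable (Rmeas m) (\<lambda>x. of_real (plog (radlap (real m) ?u) (rsq m x)) * \<phi> x)"
    using u by (intro integrable_plog \<phi> m) simp
  have i2: "integrable (Rmeas m) (\<lambda>x. of_real (plog (pl_deriv ?u) (rsq m x)) * \<phi> x)"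
    using u by (intro integrable_plog \<phi> m) simp
  have i3: "integrable (Rmeas m) (\<lambda>x. of_real (plog (radlap (real m - 2 * real (n - j)) ?u) (rsq m x)) * \<phi> x)"
    using u by (intro integrable_plog \<phi> m) simp
  have "(pl_deriv ^^ j) (radlap (real m - 2 * real n) t) = radlap (real m - 2 * real (n - j)) ?u"
    unfolding funpow_pl_deriv_radlap using j by (simp add: of_nat_diff algebra_simps)
  moreover have "(\<integral>x. of_real (plog (radlap (real m - 2 * real (n - j)) ?u) (rsq m x)) * \<phi> x \<partial>Rmeas m)
    = (\<integral>x. of_real (plog (radlap (real m) ?u) (rsq m x)) * \<phi> x
        - 4 * of_nat (n - j) * (of_real (plog (pl_deriv ?u) (rsq m x)) * \<phi> x) \<partial>Rmeas m)"
  proof (rule integral_cong_AE)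
    show "AE x in Rmeas m. of_real (plog (radlap (real m - 2 * real (n - j)) ?u) (rsq m x)) * \<phi> x
      = of_real (plog (radlap (real m) ?u) (rsq m x)) * \<phi> x
        - 4 * of_nat (n - j) * (of_real (plog (pl_deriv ?u) (rsq m x)) * \<phi> x)"
      using AE_components_neq_0
    proof (rule AE_mp, intro AE_I2 impI)
      fix x :: "nat \<Rightarrow> real" assume x: "\<forall>i<m. x i \<noteq> 0"
      show "of_real (plog (radlap (real m - 2 * real (n - j)) ?u) (rsq m x)) * \<phi> x
        = of_real (plog (radlap (real m) ?u) (rsq m x)) * \<phi> x
          - 4 * of_nat (n - j) * (of_real (plog (pl_deriv ?u) (rsq m x)) * \<phi> x)"
        unfolding plog_radlap_shift[OF rsq_pos[OF x m]] by (simp add: algebra_simps)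
    qed
  qed (use i1 i2 i3 in auto)
  moreover have "\<dots> = (\<integral>x. of_real (plog (radlap (real m) ?u) (rsq m x)) * \<phi> x \<partial>Rmeas m)
      - 4 * of_nat (n - j) * (\<integral>x. of_real (plog (pl_deriv ?u) (rsq m x)) * \<phi> x \<partial>Rmeas m)"
    using i1 i2 by (subst Bochner_Integration.integral_diff) auto
  ultimately show ?thesis
    unfolding integral_plog_blap[OF \<phi> m u] by simp
qed

text \<open>The non-strict bound after k steps gives the strict one needed at each step, since
  before every application the exponent is still larger by at least one.\<close>

lemma funpow_slap_splog_dist:
  assumes m: "m \<ge> 1" and t: "fst t - real n - real k \<ge> 1 - real m / 2"
    and T: "\<And>A \<psi>. test_fun m \<psi> \<Longrightarrow> T A \<psi> = splog_dist m n t A \<psi>" and \<phi>: "test_fun m \<phi>"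
  shows "(slap m n ^^ k) T A \<phi> = splog_dist m n ((radlap (real m - 2 * real n) ^^ k) t) A \<phi>"
  using t \<phi>
proof (induction k arbitrary: A \<phi>)
  case (Suc k)
  let ?u = "(radlap (real m - 2 * real n) ^^ k) t"
  have "(slap m n ^^ Suc k) T A \<phi> = slap m n ((slap m n ^^ k) T) A \<phi>" by simp
  also have "\<dots> = splog_dist m n (radlap (real m - 2 * real n) ?u) A \<phi>"
  proof (subst slap_splog_dist[where t = ?u and \<phi> = \<phi>])
    show "(slap m n ^^ k) T B \<psi> = splog_dist m n ?u B \<psi>" if "test_fun m \<psi>" for B \<psi>
      using Suc.prems by (intro Suc.IH that) simp
    show "(\<Sum>j\<le>n. of_real ((-1) ^ j / fact j) * pair_power n j A *
       ((\<integral>x. of_real (plog ((pl_deriv ^^ j) ?u) (rsq m x)) * blap m \<phi> x \<partial>Rmeas m)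
        - 4 * of_nat (n - j) * (\<integral>x. of_real (plog ((pl_deriv ^^ Suc j) ?u) (rsq m x)) * \<phi> x \<partial>Rmeas m)))
      = splog_dist m n (radlap (real m - 2 * real n) ?u) A \<phi>"
      unfolding splog_dist_def
    proof (intro sum.cong refl arg_cong[where f = "(*) _"])
      fix j assume "j \<in> {..n}"
      then have "j \<le> n" "real j \<le> real n" by auto
      then show "(\<integral>x. of_real (plog ((pl_deriv ^^ j) ?u) (rsq m x)) * blap m \<phi> x \<partial>Rmeas m)
        - 4 * of_nat (n - j) * (\<integral>x. of_real (plog ((pl_deriv ^^ Suc j) ?u) (rsq m x)) * \<phi> x \<partial>Rmeas m)
        = (\<integral>x. of_real (plog ((pl_deriv ^^ j) (radlap (real m - 2 * real n) ?u)) (rsq m x)) * \<phi> x \<partial>Rmeas m)"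
        using Suc.prems by (intro integral_plog_super m) auto
    qed
  qed (use Suc.prems in auto)
  finally show ?case by simp
qed (use T in simp)

text \<open>The coefficients with $j < n$ are too weakly singular to produce a delta, so they vanish as they
  do classically; only the top one is a multiple of the bosonic fundamental solution.\<close>

lemma slap_splog_dist_fundamental:
  fixes m n :: nat
  defines "M \<equiv> real m - 2 * real n"
  assumes m: "m \<ge> 1" and t: "pl_deriv t = (- M / 2, \<rho>, 0)" and M: "M / 2 \<notin> \<int>\<^sub>\<le>\<^sub>0"
    and T: "\<And>A \<psi>. test_fun m \<psi> \<Longrightarrow> T A \<psi> = splog_dist m n t A \<psi>" and \<phi>: "test_fun m \<phi>"
  shows "slap m n T A \<phi> = of_real (4 * \<rho> * pi powr (real m / 2) / (fact n * Gamma (M / 2)))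
     * pair_power n n A * \<phi> (origin m)"
proof -
  let ?I = "\<lambda>j. \<integral>x. of_real (plog ((pl_deriv ^^ j) t) (rsq m x)) * blap m \<phi> x \<partial>Rmeas m"
  let ?J = "\<lambda>j. \<integral>x. of_real (plog ((pl_deriv ^^ Suc j) t) (rsq m x)) * \<phi> x \<partial>Rmeas m"
  have fst: "fst t = 1 - real m / 2 + real n"
    using arg_cong[OF t, of fst] by (simp add: M_def field_simps)
  have low: "?I j - 4 * of_nat (n - j) * ?J j = 0" if j: "j < n" for j
  proof -
    have "real j < real n" using j by simp
    then have "fst t - real j > 1 - real m / 2" using fst by simp
    then show ?thesis
      using integral_plog_super[OF \<phi> m, of j n t] j radlap_eq_zero[OF t]
      by (simp add: M_def funpow_pl_deriv_zero)
  qed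
  \<comment> \<open>The coefficient of the (n + 1)-st derivative of h, that is, of n further
    derivatives of \<rho> s^(-M/2); the exponent has then dropped to -m/2, the critical one in
    dimension m.\<close>
  define \<sigma> where "\<sigma> = (\<Prod>i<n. - M / 2 - real i) * \<rho>"
  have "pl_deriv ((pl_deriv ^^ n) t) = (- real m / 2, \<sigma>, 0)"
  proof -
    have "pl_deriv ((pl_deriv ^^ n) t) = (pl_deriv ^^ n) (- M / 2, \<rho>, 0)"
      using t by (simp add: funpow_swap1)
    also have "\<dots> = (- real m / 2, \<sigma>, 0)"
      unfolding funpow_pl_deriv_power \<sigma>_def by (simp add: M_def field_simps)
    finally show ?thesis .
  qed
  then have top: "?I n = of_real (4 * \<sigma> * pi powr (real m / 2) / Gamma (real m / 2)) * \<phi> (origin m)"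
    by (rule integral_plog_blap_fundamental[OF \<phi> m])
  \<comment> \<open>Extracting the signs leaves the rising factorial of M/2, which is Gamma(m/2) /
    Gamma(M/2) as M/2 is not a pole.\<close>
  have \<sigma>: "(-1) ^ n * \<sigma> / Gamma (real m / 2) = \<rho> / Gamma (M / 2)"
  proof -
    have "(\<Prod>i<n. - M / 2 - real i) = (\<Prod>i<n. - 1 * (M / 2 + real i))"
      by (intro prod.cong) auto
    also have "\<dots> = (-1) ^ n * pochhammer (M / 2) n"
      unfolding prod.distrib by (simp add: pochhammer_prod atLeast0LessThan)
    also have "pochhammer (M / 2) n = Gamma (M / 2 + real n) / Gamma (M / 2)"
      using M by (rule pochhammer_Gamma)
    also have "M / 2 + real n = real m / 2" by (simp add: M_def field_simps)
    finally have "\<sigma> = (-1) ^ n * (Gamma (real m / 2) / Gamma (M / 2)) * \<rho>" by (simp add: \<sigma>_def)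
    moreover have "Gamma (real m / 2) > 0" using m by (intro Gamma_real_pos) simp
    ultimately show ?thesis by (simp add: power_mult_distrib[symmetric] mult.assoc[symmetric])
  qed
  have "slap m n T A \<phi> = (\<Sum>j\<le>n. of_real ((-1) ^ j / fact j) * pair_power n j A *
      (?I j - 4 * of_nat (n - j) * ?J j))"
    by (rule slap_splog_dist[OF T \<phi>])
  also have "\<dots> = of_real ((-1) ^ n / fact n) * pair_power n n A * ?I n"
    using low by (simp add: lessThan_Suc_atMost[symmetric])
  also have "\<dots> = of_real ((-1) ^ n / fact n * (4 * \<sigma> * pi powr (real m / 2) / Gamma (real m / 2)))
      * pair_power n n A * \<phi> (origin m)"
    unfolding top by simp
  also have "(-1) ^ n / fact n * (4 * \<sigma> * pi powr (real m / 2) / Gamma (real m / 2))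
    = 4 * ((-1) ^ n * \<sigma> / Gamma (real m / 2)) * pi powr (real m / 2) / fact n"
    by (simp add: mult_ac)
  also have "\<dots> = 4 * \<rho> * pi powr (real m / 2) / (fact n * Gamma (M / 2))"
    unfolding \<sigma> by simp
  finally show ?thesis .
qed

theorem theorem16:
  fixes m n l :: nat
  assumes "m \<ge> 1"
    and "\<not> (even (int m - 2 * int n) \<and> int m - 2 * int n \<le> 0)"
    and "l \<ge> 1"
  shows "(\<forall>A \<phi>. test_fun m \<phi> \<longrightarrow> integrable (Rmeas m) (\<lambda>x. supernu m n l x A * \<phi> x))
    \<and> (\<forall>A \<phi>. test_fun m \<phi> \<longrightarrow>
          ((slap m n ^^ l) (sdist m (supernu m n l))) A \<phi> = (-1)^l * sdelta m n A \<phi>)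
    \<and> (\<forall>x. rsq m x > 0 \<longrightarrow> supernu m n l x = sfunR2 m n (nu_equiv m n l) x)"
proof (intro conjI allI impI)
  define M where "M = int m - 2 * int n"
  have M: "odd M \<or> M > 0" using assms(2) by (auto simp: M_def)
  obtain p where p: "l = Suc p" using assms(3) by (cases l) auto
  define t where "t = nu_coeffs l M"
  have t_fst: "fst t = real l - of_int M / 2" by (simp add: t_def nu_coeffs_def)
  {
    fix A \<phi> assume "test_fun m \<phi>"
    then show "integrable (Rmeas m) (\<lambda>x. supernu m n l x A * \<phi> x)"
      using supernu_integral[OF _ assms(1,3)] by (auto simp: has_bochner_integral_iff)
  next
    fix x assume "rsq m x > 0"
    then show "supernu m n l x = sfunR2 m n (nu_equiv m n l) x"
      using supernu_eq_splog[OF assms(1,3)] nu_equiv_eq[of m n p] M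
      by (simp add: p sfunR2_plog M_def)
  next
    fix A \<phi> assume \<phi>: "test_fun m \<phi>"
    define T where "T = (slap m n ^^ p) (sdist m (supernu m n l))"
    have RM: "real m - 2 * real n = of_int M" by (simp add: M_def)
    have T: "T B \<psi> = splog_dist m n ((radlap (of_int M) ^^ p) t) B \<psi>" if "test_fun m \<psi>" for B \<psi>
      unfolding T_def RM[symmetric]
    proof (rule funpow_slap_splog_dist[OF assms(1) _ _ that])
      \<comment> \<open>Equality holds, because M/2 + n = m/2: the l - 1 subcritical steps use up
        exactly the available room, and the remaining application is the critical one.\<close>
      show "1 - real m / 2 \<le> fst t - real n - real p"
        unfolding t_fst by (simp add: p M_def field_simps)
      show "sdist m (supernu m n l) B \<psi> = splog_dist m n t B \<psi>" if "test_fun m \<psi>" for B \<psi>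
        using supernu_integral[OF that assms(1,3), of n B]
        by (simp add: sdist_def t_def M_def has_bochner_integral_iff)
    qed
    define \<rho> where "\<rho> = (-1) ^ l * Gamma (of_int M / 2) / (4 * pi powr (of_int M / 2) :: real)"
    have M_pole: "real_of_int M / 2 \<notin> \<int>\<^sub>\<le>\<^sub>0"
    proof
      assume "real_of_int M / 2 \<in> \<int>\<^sub>\<le>\<^sub>0"
      then obtain k where k: "real_of_int M / 2 = of_int k" "k \<le> 0"
        by (auto elim!: nonpos_Ints_cases)
      then have "real_of_int M = of_int (2 * k)" by simp
      then have "M = 2 * k" by (simp only: of_int_eq_iff)
      with M k show False by auto
    qed
    have "pl_deriv ((radlap (of_int M) ^^ p) t) = (- of_int M / 2, \<rho>, 0)"
      using pl_deriv_funpow_radlap_nu_coeffs[OF M, of p] by (simp only: t_def \<rho>_def p)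
    then have "slap m n T A \<phi> = of_real (4 * \<rho> * pi powr (real m / 2) / (fact n * Gamma (of_int M / 2)))
        * pair_power n n A * \<phi> (origin m)"
      using slap_splog_dist_fundamental[OF assms(1), where \<rho> = \<rho> and n = n, OF _ _ T \<phi>] M_pole by (simp add: RM)
    \<comment> \<open>Gamma(M/2) and 4 pi^(M/2) cancel against \<rho>, and the excess pi^(m/2 - M/2)
      = pi^n is the factor in the super delta.\<close>
    also have "4 * \<rho> * pi powr (real m / 2) / (fact n * Gamma (of_int M / 2)) = (-1) ^ l * (pi ^ n / fact n)"
    proof -
      have "Gamma (of_int M / 2 :: real) \<noteq> 0" using M_pole by (simp add: Gamma_eq_zero_iff)
      moreover have m2: "real m / 2 = of_int M / 2 + real n" by (simp add: M_def field_simps)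
      have "pi powr (real m / 2) = pi powr (of_int M / 2) * pi ^ n"
        unfolding m2 by (simp only: powr_add powr_realpow pi_gt_zero)
      ultimately show ?thesis by (simp add: \<rho>_def)
    qed
    finally show "(slap m n ^^ l) (sdist m (supernu m n l)) A \<phi> = (-1) ^ l * sdelta m n A \<phi>"
      by (simp add: p T_def sdelta_def gpow_xgr2)
  }
qed

end
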